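(* Let $(M,\omega)$ be a pre-$n$-plectic manifold, $H\in\Omega^{n-1}_{\mathrm{Ham}}(M)$, and let $(f)=\{f_i\}_{1\le i\le n}$ be a co-momentum map for a multisymplectic infinitesimal action $\mathfrak g\to\mathfrak X(M,\omega)$, $x\mapsto v_x$, which is locally $H$-preserving, i.e. $\mathcal L_{v_x}H$ is closed for all $x\in\mathfrak g$. Let $p\in Z_k(\mathfrak g)$, $1\le k\le n$. Then $f_k(p)$ is locally conserved by any Hamiltonian vector field $v_H$ of $H$, i.e. $\mathcal L_{v_H}f_k(p)$ is a closed form.
   Context: A pre-$n$-plectic manifold ($n\ge 1$) is a smooth manifold $M$ with a closed form $\omega\in\Omega^{n+1}(M)$. A form $\alpha\in\Omega^{n-1}(M)$ is Hamiltonian if there is a vector field $v_\alpha$ (a Hamiltonian vector field for $\alpha$; not necessarily unique) with $d\alpha=-\iota_{v_\alpha}\omega$; $\Omega^{n-1}_{\mathrm{Ham}}(M)$ is the set of Hamiltonian $(n-1)$-forms. Contraction with multivector fields: $\iota(v_1\wedge\dots\wedge v_k)=\iota_{v_k}\cdots\iota_{v_1}$. $\mathfrak g$ is a real Lie algebra; a multisymplectic infinitesimal action is a Lie algebra homomorphism $x\mapsto v_x$ from $\mathfrak g$ to $\mathfrak X(M,\omega)=\{X\in\mathfrak X(M):\mathcal L_X\omega=0\}$. For $p=x_1\wedge\dots\wedge x_k$ put $v_p=v_{x_1}\wedge\dots\wedge v_{x_k}$, extended linearly to $p\in\Lambda^k\mathfrak g$. Lie algebra homology differential: $\partial_k:\Lambda^k\mathfrak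 g\to\Lambda^{k-1}\mathfrak g$, $\partial(x_1\wedge\dots\wedge x_k)=\sum_{1\le i<j\le k}(-1)^{i+j}[x_i,x_j]\wedge x_1\wedge\dots\wedge\hat x_i\wedge\dots\wedge\hat x_j\wedge\dots\wedge x_k$; $Z_k(\mathfrak g)=\ker\partial_k$. Let $\varsigma(k)=-(-1)^{k(k+1)/2}$. A (homotopy) co-momentum map is a collection of linear maps $f_i:\Lambda^i\mathfrak g\to\Omega^{n-i}(M)$, $1\le i\le n$, with $f_1(\mathfrak g)\subset\Omega^{n-1}_{\mathrm{Ham}}(M)$, $d(f_1(x))=-\iota_{v_x}\omega$ for all $x\in\mathfrak g$, and, setting $f_0=f_{n+1}=0$, $-f_{k-1}(\partial p)=df_k(p)+\varsigma(k)\iota(v_p)\omega$ for all $1\le k\le n+1$, $p\in\Lambda^k\mathfrak g$. *)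

theory Defs
  imports "HOL-Analysis.Analysis" "HOL-Library.Function_Algebras" "HOL-Library.Poly_Mapping"
begin

section \<open>Real vector spaces of functions\<close>

instantiation "fun" :: (type, real_vector) real_vector
begin

definition scaleR_fun :: "real \<Rightarrow> ('a \<Rightarrow> 'b) \<Rightarrow> 'a \<Rightarrow> 'b"
  where "scaleR_fun c f = (\<lambda>x. c *\<^sub>R f x)"

instance
  by standard (auto simp: scaleR_fun_def plus_fun_def algebra_simps)

end

lemma scaleR_fun_apply [simp]: "(c *\<^sub>R f) x = c *\<^sub>R f x"
  by (simp add: scaleR_fun_def)

instantiation poly_mapping :: (type, real_vector) real_vector
begin

lift_definition scaleR_poly_mapping :: "real \<Rightarrow> ('a \<Rightarrow>\<^sub>0 'b) \<Rightarrow> 'a \<Rightarrow>\<^sub>0 'b"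
  is "\<lambda>c f x. c *\<^sub>R f x"
  by (erule finite_subset [rotated]) auto

instance
  by standard (transfer; auto simp: algebra_simps)+

end

lemma lookup_scaleR [simp]: "Poly_Mapping.lookup (c *\<^sub>R P) x = c *\<^sub>R Poly_Mapping.lookup P x"
  by transfer simp


section \<open>The exterior algebra of a real vector space\<close>

text \<open>
  The free vector space on the finite lists (the words of the tensor algebra), divided by the
  relations of multilinearity and by the ideal generated by the squares of vectors.
\<close>

abbreviation word :: "'g list \<Rightarrow> 'g list \<Rightarrow>\<^sub>0 real"
  where "word xs \<equiv> Poly_Mapping.single xs 1"

definition ext_relators :: "('g::real_vector list \<Rightarrow>\<^sub>0 real) set" where
  "ext_relators =
     {word (xs @ (c *\<^sub>R x + y) # ys) - c *\<^sub>R word (xs @ x # ys) - word (xs @ y # ys) | xs ys c x y. True}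
     \<union> {word (xs @ x # x # ys) | xs ys x. True}"

definition ext_eq :: "('g::real_vector list \<Rightarrow>\<^sub>0 real) \<Rightarrow> ('g list \<Rightarrow>\<^sub>0 real) \<Rightarrow> bool"
  where "ext_eq P Q \<longleftrightarrow> P - Q \<in> span ext_relators"

lemma equivp_ext_eq: "equivp (ext_eq :: ('g::real_vector list \<Rightarrow>\<^sub>0 real) \<Rightarrow> _)"
proof (rule equivpI)
  show "reflp (ext_eq :: ('g list \<Rightarrow>\<^sub>0 real) \<Rightarrow> _)"
    by (simp add: reflp_def ext_eq_def span_zero)
  show "symp (ext_eq :: ('g list \<Rightarrow>\<^sub>0 real) \<Rightarrow> _)"
    unfolding symp_def ext_eq_def by (intro allI impI, drule span_neg) simp
  show "transp (ext_eq :: ('g list \<Rightarrow>\<^sub>0 real) \<Rightarrow> _)"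
    unfolding transp_def ext_eq_def by (intro allI impI, drule (1) span_add) simp
qed

quotient_type (overloaded) 'g ext = "'g::real_vector list \<Rightarrow>\<^sub>0 real" / ext_eq
  by (rule equivp_ext_eq)

instantiation ext :: (real_vector) real_vector
begin

lift_definition zero_ext :: "'a ext" is 0 .

lift_definition plus_ext :: "'a ext \<Rightarrow> 'a ext \<Rightarrow> 'a ext" is "(+)"
  unfolding ext_eq_def by (drule (1) span_add) (simp add: algebra_simps)

lift_definition uminus_ext :: "'a ext \<Rightarrow> 'a ext" is uminus
  unfolding ext_eq_def by (drule span_neg) (simp add: algebra_simps)

lift_definition minus_ext :: "'a ext \<Rightarrow> 'a ext \<Rightarrow> 'a ext" is "(-)"
  unfolding ext_eq_def by (drule (1) span_diff) (simp add: algebra_simps)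

lift_definition scaleR_ext :: "real \<Rightarrow> 'a ext \<Rightarrow> 'a ext" is "(*\<^sub>R)"
  unfolding ext_eq_def by (drule span_scale) (simp add: scaleR_right_diff_distrib)

instance
  by standard (transfer; simp add: ext_eq_def span_zero algebra_simps)+

end

lift_definition wedge :: "'g::real_vector list \<Rightarrow> 'g ext" is word .

definition ext_power :: "nat \<Rightarrow> 'g::real_vector ext set" (\<open>\<Lambda>\<close>)
  where "ext_power k = span {wedge xs | xs. length xs = k}"

definition free_extend :: "('g list \<Rightarrow> 'b::real_vector) \<Rightarrow> ('g list \<Rightarrow>\<^sub>0 real) \<Rightarrow> 'b" where
  "free_extend \<phi> P = (\<Sum>xs \<in> Poly_Mapping.keys P. Poly_Mapping.lookup P xs *\<^sub>R \<phi> xs)"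

text \<open>
  The linear map on the exterior algebra that sends \<^term>\<open>wedge xs\<close> to \<^term>\<open>\<phi> xs\<close>, provided that
  \<open>\<phi>\<close> is multilinear and alternating (see the lemma \<open>ext_extend_wedge\<close> below).
\<close>

definition ext_extend :: "('g::real_vector list \<Rightarrow> 'b::real_vector) \<Rightarrow> 'g ext \<Rightarrow> 'b"
  where "ext_extend \<phi> p = free_extend \<phi> (rep_ext p)"

definition alternating :: "('g::real_vector list \<Rightarrow> 'b::real_vector) \<Rightarrow> bool" where
  "alternating \<phi> \<longleftrightarrow>
     (\<forall>xs ys c x y. \<phi> (xs @ (c *\<^sub>R x + y) # ys) = c *\<^sub>R \<phi> (xs @ x # ys) + \<phi> (xs @ y # ys))
     \<and> (\<forall>xs ys x. \<phi> (xs @ x # x # ys) = 0)"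

lemma free_extend_superset:
  assumes "finite S" "Poly_Mapping.keys P \<subseteq> S"
  shows "free_extend \<phi> P = (\<Sum>xs \<in> S. Poly_Mapping.lookup P xs *\<^sub>R \<phi> xs)"
  unfolding free_extend_def
  by (rule sum.mono_neutral_left) (use assms in \<open>auto simp: in_keys_iff\<close>)

lemma linear_free_extend: "linear (free_extend \<phi>)"
proof (rule linearI)
  fix P Q :: "'a list \<Rightarrow>\<^sub>0 real" and c :: real
  let ?S = "Poly_Mapping.keys P \<union> Poly_Mapping.keys Q"
  have "Poly_Mapping.keys (P + Q) \<subseteq> ?S" by (rule Poly_Mapping.keys_add)
  then show "free_extend \<phi> (P + Q) = free_extend \<phi> P + free_extend \<phi> Q"
    by (simp add: free_extend_superset [of ?S] lookup_add scaleR_add_left sum.distrib)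
  have "Poly_Mapping.keys (c *\<^sub>R P) \<subseteq> Poly_Mapping.keys P"
    by (auto simp: in_keys_iff)
  then show "free_extend \<phi> (c *\<^sub>R P) = c *\<^sub>R free_extend \<phi> P"
    by (simp add: free_extend_superset [of "Poly_Mapping.keys P"] scaleR_sum_right)
qed

lemma free_extend_word [simp]: "free_extend \<phi> (word xs) = \<phi> xs"
  by (simp add: free_extend_def)

lemma free_extend_ext_eq:
  assumes "alternating \<phi>" "ext_eq P Q"
  shows "free_extend \<phi> P = free_extend \<phi> Q"
proof -
  interpret linear "free_extend \<phi>" by (rule linear_free_extend)
  have "free_extend \<phi> R = 0" if "R \<in> span ext_relators" for R
    using that
  proof (rule span_induct)
    show "subspace {R. free_extend \<phi> R = 0}"
      by (auto simp: subspace_def add zero scale)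
    show "R \<in> ext_relators \<Longrightarrow> free_extend \<phi> R = 0" for R
      using assms(1) by (auto simp: ext_relators_def alternating_def diff scale)
  qed
  from this [of "P - Q"] show ?thesis
    using assms(2) by (simp add: ext_eq_def diff)
qed

lemma ext_eq_rep_abs: "ext_eq (rep_ext (abs_ext P)) P"
  by (simp add: ext.abs_eq_iff [symmetric] Quotient_abs_rep [OF Quotient_ext])

lemma ext_extend_abs: "alternating \<phi> \<Longrightarrow> ext_extend \<phi> (abs_ext P) = free_extend \<phi> P"
  unfolding ext_extend_def by (rule free_extend_ext_eq [OF _ ext_eq_rep_abs])

lemma ext_extend_wedge: "alternating \<phi> \<Longrightarrow> ext_extend \<phi> (wedge xs) = \<phi> xs"
  by (simp add: wedge_def ext_extend_abs)

lemma linear_ext_extend: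
  assumes "alternating \<phi>"
  shows "linear (ext_extend \<phi>)"
proof -
  interpret linear "free_extend \<phi>" by (rule linear_free_extend)
  show ?thesis
  proof (rule linearI)
    show "ext_extend \<phi> (p + q) = ext_extend \<phi> p + ext_extend \<phi> q" for p q
      by (induct p rule: ext.abs_induct, induct q rule: ext.abs_induct)
        (simp add: plus_ext.abs_eq ext_extend_abs [OF assms] add)
    show "ext_extend \<phi> (c *\<^sub>R p) = c *\<^sub>R ext_extend \<phi> p" for c p
      by (induct p rule: ext.abs_induct)
        (simp add: scaleR_ext.abs_eq ext_extend_abs [OF assms] scale)
  qed
qed

lemma alternating_wedge: "alternating wedge"
  unfolding alternating_def
proof (intro conjI allI)
  fix xs ys :: "'a list" and c x y
  have "word (xs @ (c *\<^sub>R x + y) # ys) - c *\<^sub>R word (xs @ x # ys) - word (xs @ y # ys)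
      \<in> span ext_relators"
    by (rule span_base) (unfold ext_relators_def, blast)
  then show "wedge (xs @ (c *\<^sub>R x + y) # ys) = c *\<^sub>R wedge (xs @ x # ys) + wedge (xs @ y # ys)"
    by (simp add: wedge_def scaleR_ext.abs_eq plus_ext.abs_eq ext.abs_eq_iff ext_eq_def diff_diff_eq)
  have "word (xs @ x # x # ys) \<in> span ext_relators"
    by (rule span_base) (unfold ext_relators_def, blast)
  then show "wedge (xs @ x # x # ys) = 0"
    by (simp add: wedge_def zero_ext.abs_eq ext.abs_eq_iff ext_eq_def)
qed


section \<open>Lie algebras and the homology differential\<close>

definition lie_algebra :: "('g::real_vector \<Rightarrow> 'g \<Rightarrow> 'g) \<Rightarrow> bool" where
  "lie_algebra br \<longleftrightarrow> bilinear br \<and> (\<forall>x. br x x = 0)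
     \<and> (\<forall>x y z. br x (br y z) + br y (br z x) + br z (br x y) = 0)"

text \<open>
  Positions in lists count from 0, which does not affect the parity of \<open>i + j\<close>;
  \<^term>\<open>nths xs (- {i, j})\<close> is the list without the entries at positions \<open>i\<close> and \<open>j\<close>.
\<close>

definition boundary_word :: "('g::real_vector \<Rightarrow> 'g \<Rightarrow> 'g) \<Rightarrow> 'g list \<Rightarrow> 'g ext" where
  "boundary_word br xs =
     (\<Sum>j<length xs. \<Sum>i<j. (-1) ^ (i + j) *\<^sub>R wedge (br (xs ! i) (xs ! j) # nths xs (- {i, j})))"

definition boundary :: "('g::real_vector \<Rightarrow> 'g \<Rightarrow> 'g) \<Rightarrow> 'g ext \<Rightarrow> 'g ext"
  where "boundary br = ext_extend (boundary_word br)"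

definition cycles :: "('g::real_vector \<Rightarrow> 'g \<Rightarrow> 'g) \<Rightarrow> nat \<Rightarrow> 'g ext set"
  where "cycles br k = {p \<in> \<Lambda> k. boundary br p = 0}"

lemma nths_split:
  "nths (xs @ x # ys) A =
     nths xs A @ (if length xs \<in> A then [x] else []) @ nths ys {j. Suc (j + length xs) \<in> A}"
  by (auto simp: nths_append nths_Cons)

lemma nths_swap:
  assumes "\<And>k. k \<noteq> length xs \<Longrightarrow> k \<noteq> Suc (length xs) \<Longrightarrow> k \<in> A \<longleftrightarrow> k \<in> B"
    and "length xs \<in> A \<longleftrightarrow> Suc (length xs) \<in> B" "Suc (length xs) \<in> A \<longleftrightarrow> length xs \<in> B"
  shows "nths (xs @ x # x # ys) A = nths (xs @ x # x # ys) B"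
proof -
  have "nths xs A = nths xs B"
    unfolding nths_def by (rule arg_cong [of _ _ "map fst"], rule filter_cong)
      (use assms(1) in \<open>auto simp: set_zip\<close>)
  moreover have "{j. Suc (Suc (j + length xs)) \<in> A} = {j. Suc (Suc (j + length xs)) \<in> B}"
    using assms(1) by auto
  ultimately show ?thesis
    using assms(2,3) by (simp add: nths_split nths_Cons)
qed

lemma wedge_linear:
  "wedge (xs @ (c *\<^sub>R x + y) # ys) = c *\<^sub>R wedge (xs @ x # ys) + wedge (xs @ y # ys)"
  using alternating_wedge unfolding alternating_def by blast

lemma wedge_repeated: "wedge (xs @ x # x # ys) = 0"
  using alternating_wedge unfolding alternating_def by blast

lemma boundary_word_alternating:
  assumes "lie_algebra br"
  shows "alternating (boundary_word br)"
  unfolding alternating_def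
proof (intro conjI allI)
  have br_left: "br (c *\<^sub>R x + y) z = c *\<^sub>R br x z + br y z"
    and br_right: "br z (c *\<^sub>R x + y) = c *\<^sub>R br z x + br z y" for c x y z
    using assms by (auto simp: lie_algebra_def bilinear_def linear_iff)
  have br_self: "br x x = 0" for x
    using assms by (auto simp: lie_algebra_def)
  show "boundary_word br (xs @ (c *\<^sub>R x + y) # ys)
      = c *\<^sub>R boundary_word br (xs @ x # ys) + boundary_word br (xs @ y # ys)" for xs ys c x y
  proof -
    let ?t = "\<lambda>z i j. wedge (br ((xs @ z # ys) ! i) ((xs @ z # ys) ! j) # nths (xs @ z # ys) (- {i, j}))"
    have t: "?t (c *\<^sub>R x + y) i j = c *\<^sub>R ?t x i j + ?t y i j" if "i < j" for i j
    proof -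
      consider "i = length xs" | "j = length xs" | "i \<noteq> length xs" "j \<noteq> length xs" by blast
      then show ?thesis
      proof cases
        case 1
        with that show ?thesis
          using wedge_linear [of "[]"] by (simp add: nths_split nth_append nth_Cons' br_left)
      next
        case 2
        with that show ?thesis
          using wedge_linear [of "[]"] by (simp add: nths_split nth_append br_right)
      next
        case 3
        then show ?thesis
          using wedge_linear [of "_ # nths xs (- {i, j})"]
          by (simp add: nths_split nth_append nth_Cons')
      qed
    qed
    show ?thesis
      unfolding boundary_word_def
      by (simp add: t scaleR_add_right sum.distrib scaleR_sum_right mult.commute)
  qed
  show "boundary_word br (xs @ x # x # ys) = 0" for xs ys x
  proof -
    let ?L = "xs @ x # x # ys" and ?n = "length xs"
    let ?t = "\<lambda>i j. (-1) ^ (i + j) *\<^sub>R wedge (br (?L ! i) (?L ! j) # nths ?L (- {i, j}))"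
    let ?P = "{(i, j). i < j \<and> j < length ?L}"
    define \<tau> where "\<tau> i = (if i = ?n then Suc ?n else if i = Suc ?n then ?n else i)" for i
    have \<tau>\<tau>: "\<tau> (\<tau> i) = i" for i by (simp add: \<tau>_def)
    have [simp]: "?L ! \<tau> i = ?L ! i" for i
      by (simp add: \<tau>_def nth_append)
    have fin: "finite ?P"
      by (rule finite_subset [of _ "{..<length ?L} \<times> {..<length ?L}"]) auto
    have "boundary_word br ?L = (\<Sum>(i, j) \<in> ?P. ?t i j)"
    proof -
      have "boundary_word br ?L = (\<Sum>(j, i) \<in> (SIGMA j:{..<length ?L}. {..<j}). ?t i j)"
        unfolding boundary_word_def by (subst sum.Sigma) auto
      also have "\<dots> = (\<Sum>(i, j) \<in> ?P. ?t i j)"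
        by (rule sum.reindex_bij_witness [of _ prod.swap prod.swap]) auto
      finally show ?thesis .
    qed
    also have "\<dots> = (\<Sum>(i, j) \<in> ?P - {(?n, Suc ?n)}. ?t i j)"
    proof (rule sum.mono_neutral_right [OF fin])
      have "wedge (0 # zs) = 0" for zs :: "'a list"
        using wedge_linear [of "[]" 1 0 0 zs] by simp
      then show "\<forall>q \<in> ?P - (?P - {(?n, Suc ?n)}). (case q of (i, j) \<Rightarrow> ?t i j) = 0"
        by (auto simp: nth_append br_self)
    qed auto
    also have "\<dots> = 0"
    proof -
      let ?Q = "?P - {(?n, Suc ?n)}"
      have anti: "?t (\<tau> i) (\<tau> j) = - ?t i j" if "(i, j) \<in> ?Q" for i j
      proof (cases "{i, j} \<inter> {?n, Suc ?n} = {}")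
        case True
        then have "wedge (br (?L ! i) (?L ! j) # nths ?L (- {i, j})) = 0"
          using wedge_repeated [of "_ # nths xs (- {i, j})"] by (simp add: nths_split nths_Cons)
        with True show ?thesis by (simp add: \<tau>_def)
      next
        case False
        have "nths ?L (- {\<tau> i, \<tau> j}) = nths ?L (- {i, j})"
          by (rule nths_swap) (auto simp: \<tau>_def)
        moreover have "(-1::real) ^ (\<tau> i + \<tau> j) = - ((-1) ^ (i + j))"
          using False that by (auto simp: \<tau>_def)
        ultimately show ?thesis by simp
      qed
      have "(\<Sum>(i, j) \<in> ?Q. ?t i j) = (\<Sum>(i, j) \<in> ?Q. ?t (\<tau> i) (\<tau> j))"
        by (rule sum.reindex_bij_witness [of _ "map_prod \<tau> \<tau>" "map_prod \<tau> \<tau>"])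
          (auto simp: \<tau>\<tau>, auto simp: \<tau>_def split: if_splits)
      also have "\<dots> = - (\<Sum>(i, j) \<in> ?Q. ?t i j)"
        unfolding sum_negf [symmetric] by (rule sum.cong) (use anti in auto)
      finally show ?thesis
        by (simp only: eq_neg_iff_add_eq_0 scaleR_2 [symmetric]) simp
    qed
    finally show ?thesis .
  qed
qed

lemma boundary_wedge:
  "lie_algebra br \<Longrightarrow> boundary br (wedge xs) =
     (\<Sum>j<length xs. \<Sum>i<j. (-1) ^ (i + j) *\<^sub>R wedge (br (xs ! i) (xs ! j) # nths xs (- {i, j})))"
  by (simp add: boundary_def ext_extend_wedge boundary_word_alternating boundary_word_def)

lemma linear_boundary: "lie_algebra br \<Longrightarrow> linear (boundary br)"
  by (simp add: boundary_def linear_ext_extend boundary_word_alternating)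


section \<open>Smooth manifolds\<close>

text \<open>
  \<open>Ck_on m k V f\<close>: on the subset \<open>V\<close> of \<open>m\<close>-dimensional space, open in that space, the function \<open>f\<close>
  has continuous iterated partial derivatives up to order \<open>k\<close>.
\<close>

primrec Ck_on :: "nat \<Rightarrow> nat \<Rightarrow> (nat \<Rightarrow> real) set \<Rightarrow> ((nat \<Rightarrow> real) \<Rightarrow> real) \<Rightarrow> bool" where
  "Ck_on m 0 V f \<longleftrightarrow> continuous_map (subtopology (Euclidean_space m) V) euclideanreal f"
| "Ck_on m (Suc k) V f \<longleftrightarrow>
     continuous_map (subtopology (Euclidean_space m) V) euclideanreal f \<and>
     (\<forall>i<m. \<exists>g. (\<forall>x\<in>V. ((\<lambda>t. f (x(i := t))) has_real_derivative g x) (at (x i))) \<and> Ck_on m k V g)"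

definition smooth_on :: "nat \<Rightarrow> (nat \<Rightarrow> real) set \<Rightarrow> ((nat \<Rightarrow> real) \<Rightarrow> real) \<Rightarrow> bool"
  where "smooth_on m V f \<longleftrightarrow> (\<forall>k. Ck_on m k V f)"

text \<open>
  The points are those of the type \<open>'m\<close>; any dimension, including 0, is allowed. An atlas consists
  of pairs \<open>(U, \<phi>)\<close> of a domain and a chart map.
\<close>

record 'm manifold =
  mdim :: nat
  atlas :: "('m set \<times> ('m \<Rightarrow> nat \<Rightarrow> real)) set"

definition smooth_manifold :: "'m::{t2_space, second_countable_topology} manifold \<Rightarrow> bool" where
  "smooth_manifold M \<longleftrightarrow>
     (\<Union>(U, \<phi>) \<in> atlas M. U) = UNIV \<and>
     (\<forall>(U, \<phi>) \<in> atlas M. open U \<and> openin (Euclidean_space (mdim M)) (\<phi> ` U) \<and>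
        homeomorphic_map (top_of_set U) (subtopology (Euclidean_space (mdim M)) (\<phi> ` U)) \<phi>) \<and>
     (\<forall>(U, \<phi>) \<in> atlas M. \<forall>(U', \<phi>') \<in> atlas M. \<forall>i<mdim M.
        smooth_on (mdim M) (\<phi> ` (U \<inter> U')) (\<lambda>x. \<phi>' (inv_into U \<phi> x) i))"

definition smooth_functions :: "'m manifold \<Rightarrow> ('m \<Rightarrow> real) set" (\<open>C\<^sup>\<infinity>\<close>) where
  "C\<^sup>\<infinity> M = {f. \<forall>(U, \<phi>) \<in> atlas M. smooth_on (mdim M) (\<phi> ` U) (\<lambda>x. f (inv_into U \<phi> x))}"


section \<open>Vector fields and differential forms\<close>

text \<open>
  As in Helgason's \<^emph>\<open>Differential Geometry, Lie Groups, and Symmetric Spaces\<close> (Chapter I, Section 2),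
  vector fields are the derivations of the algebra of smooth functions, and \<open>k\<close>-forms are the
  alternating maps in \<open>k\<close> vector fields, multilinear over the smooth functions. For equality of
  maps to mean equality on their domains, derivations are 0 on functions that are not smooth,
  and \<open>k\<close>-forms are 0 on everything but lists of \<open>k\<close> vector fields.
\<close>

type_synonym 'm vfield = "('m \<Rightarrow> real) \<Rightarrow> ('m \<Rightarrow> real)"
type_synonym 'm dform = "'m vfield list \<Rightarrow> ('m \<Rightarrow> real)"

definition vector_fields :: "'m manifold \<Rightarrow> 'm vfield set" (\<open>\<XX>\<close>) where
  "\<XX> M = {X.
     (\<forall>f \<in> C\<^sup>\<infinity> M. X f \<in> C\<^sup>\<infinity> M) \<and> (\<forall>f. f \<notin> C\<^sup>\<infinity> M \<longrightarrow> X f = 0) \<and>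
     (\<forall>f \<in> C\<^sup>\<infinity> M. \<forall>g \<in> C\<^sup>\<infinity> M. \<forall>c. X (c *\<^sub>R f + g) = c *\<^sub>R X f + X g) \<and>
     (\<forall>f \<in> C\<^sup>\<infinity> M. \<forall>g \<in> C\<^sup>\<infinity> M. X (f * g) = f * X g + X f * g)}"

definition vf_bracket :: "'m vfield \<Rightarrow> 'm vfield \<Rightarrow> 'm vfield"
  where "vf_bracket X Y = (\<lambda>f. X (Y f) - Y (X f))"

definition forms :: "'m manifold \<Rightarrow> nat \<Rightarrow> 'm dform set" (\<open>\<Omega>\<close>) where
  "\<Omega> M k = {\<alpha>.
     (\<forall>Xs. length Xs = k \<and> set Xs \<subseteq> \<XX> M \<longrightarrow> \<alpha> Xs \<in> C\<^sup>\<infinity> M) \<and>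
     (\<forall>Xs. \<not> (length Xs = k \<and> set Xs \<subseteq> \<XX> M) \<longrightarrow> \<alpha> Xs = 0) \<and>
     (\<forall>Xs Ys X Y. \<forall>g \<in> C\<^sup>\<infinity> M. set (Xs @ X # Y # Ys) \<subseteq> \<XX> M \<longrightarrow>
        \<alpha> (Xs @ (\<lambda>f. g * X f + Y f) # Ys) = g * \<alpha> (Xs @ X # Ys) + \<alpha> (Xs @ Y # Ys)) \<and>
     (\<forall>Xs. set Xs \<subseteq> \<XX> M \<and> \<not> distinct Xs \<longrightarrow> \<alpha> Xs = 0)}"

definition ext_deriv :: "'m manifold \<Rightarrow> 'm dform \<Rightarrow> 'm dform" (\<open>\<d>\<close>) where
  "\<d> M \<alpha> = (\<lambda>Xs. if set Xs \<subseteq> \<XX> M then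
       (\<Sum>i<length Xs. (-1) ^ i *\<^sub>R (Xs ! i) (\<alpha> (nths Xs (- {i}))))
     + (\<Sum>j<length Xs. \<Sum>i<j. (-1) ^ (i + j) *\<^sub>R \<alpha> (vf_bracket (Xs ! i) (Xs ! j) # nths Xs (- {i, j})))
     else 0)"

definition lie_deriv :: "'m manifold \<Rightarrow> 'm vfield \<Rightarrow> 'm dform \<Rightarrow> 'm dform" (\<open>\<L>\<close>) where
  "\<L> M X \<alpha> = (\<lambda>Ys. if set Ys \<subseteq> \<XX> M then
     X (\<alpha> Ys) - (\<Sum>i<length Ys. \<alpha> (Ys[i := vf_bracket X (Ys ! i)])) else 0)"

definition contract :: "'m vfield \<Rightarrow> 'm dform \<Rightarrow> 'm dform"
  where "contract X \<alpha> = (\<lambda>Ys. \<alpha> (X # Ys))"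

definition closed_form :: "'m manifold \<Rightarrow> nat \<Rightarrow> 'm dform \<Rightarrow> bool"
  where "closed_form M k \<alpha> \<longleftrightarrow> \<alpha> \<in> \<Omega> M k \<and> \<d> M \<alpha> = 0"


section \<open>Multisymplectic geometry\<close>

definition pre_plectic :: "'m::{t2_space, second_countable_topology} manifold \<Rightarrow> nat \<Rightarrow> 'm dform \<Rightarrow> bool"
  where "pre_plectic M n \<omega> \<longleftrightarrow> smooth_manifold M \<and> n \<ge> 1 \<and> closed_form M (n + 1) \<omega>"

definition hamiltonian_vf :: "'m manifold \<Rightarrow> 'm dform \<Rightarrow> 'm dform \<Rightarrow> 'm vfield \<Rightarrow> bool"
  where "hamiltonian_vf M \<omega> \<alpha> X \<longleftrightarrow> X \<in> \<XX> M \<and> \<d> M \<alpha> = - contract X \<omega>"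

definition hamiltonian_forms :: "'m manifold \<Rightarrow> nat \<Rightarrow> 'm dform \<Rightarrow> 'm dform set" where
  "hamiltonian_forms M n \<omega> = {\<alpha> \<in> \<Omega> M (n - 1). \<exists>X. hamiltonian_vf M \<omega> \<alpha> X}"

definition multisymplectic_action ::
  "'m manifold \<Rightarrow> 'm dform \<Rightarrow> ('g::real_vector \<Rightarrow> 'g \<Rightarrow> 'g) \<Rightarrow> ('g \<Rightarrow> 'm vfield) \<Rightarrow> bool" where
  "multisymplectic_action M \<omega> br v \<longleftrightarrow>
     (\<forall>x. v x \<in> \<XX> M \<and> \<L> M (v x) \<omega> = 0) \<and> linear v \<and> (\<forall>x y. v (br x y) = vf_bracket (v x) (v y))"

text \<open>
  Contraction with the multivector field \<open>v\<^sub>p\<close>: the linear extension in \<open>p\<close> of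
  \<open>x\<^sub>1 \<and> \<dots> \<and> x\<^sub>k \<mapsto> \<iota>(v x\<^sub>k) \<cdots> \<iota>(v x\<^sub>1)\<close>.
\<close>

definition contract_ext :: "('g::real_vector \<Rightarrow> 'm vfield) \<Rightarrow> 'g ext \<Rightarrow> 'm dform \<Rightarrow> 'm dform"
  where "contract_ext v p \<alpha> = ext_extend (\<lambda>xs. fold (\<lambda>x. contract (v x)) xs \<alpha>) p"

lemma fold_contract: "fold (\<lambda>x. contract (v x)) xs \<alpha> = (\<lambda>Ys. \<alpha> (map v xs @ Ys))"
proof (induction xs arbitrary: \<alpha>)
  case (Cons x xs)
  show ?case
    by (simp add: Cons.IH) (simp add: contract_def)
qed simp

lemma const_smooth: "(\<lambda>_. c) \<in> C\<^sup>\<infinity> M"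
proof -
  have "Ck_on m k V (\<lambda>_. c)" for m k V and c :: real
    by (induction k arbitrary: c) (auto intro!: exI [of _ "\<lambda>_. 0"])
  then show ?thesis
    by (auto simp: smooth_functions_def smooth_on_def)
qed

lemma alternating_contract:
  fixes v :: "'g::real_vector \<Rightarrow> 'm vfield"
  assumes "\<alpha> \<in> \<Omega> M k" "linear v" and v: "\<And>x. v x \<in> \<XX> M"
  shows "alternating (\<lambda>xs. fold (\<lambda>x. contract (v x)) xs \<alpha>)"
  unfolding alternating_def fold_contract
proof (intro conjI allI; rule ext)
  fix xs ys :: "'g list" and c x y and Ys
  have zero: "\<alpha> (Xs @ Ys) = 0" if "\<not> set Ys \<subseteq> \<XX> M" for Xs
    using assms(1) that by (auto simp: forms_def)
  have vs: "set (map v zs) \<subseteq> \<XX> M" for zs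
    using v by auto
  show "\<alpha> (map v (xs @ (c *\<^sub>R x + y) # ys) @ Ys)
      = (c *\<^sub>R (\<lambda>Ys. \<alpha> (map v (xs @ x # ys) @ Ys)) + (\<lambda>Ys. \<alpha> (map v (xs @ y # ys) @ Ys))) Ys"
  proof (cases "set Ys \<subseteq> \<XX> M")
    case True
    have comb: "v (c *\<^sub>R x + y) = (\<lambda>f. (\<lambda>_. c) * v x f + v y f)"
      using \<open>linear v\<close> by (auto simp: linear_add linear_scale fun_eq_iff)
    have "\<alpha> (map v xs @ (\<lambda>f. (\<lambda>_. c) * v x f + v y f) # (map v ys @ Ys))
        = (\<lambda>_. c) * \<alpha> (map v xs @ v x # (map v ys @ Ys)) + \<alpha> (map v xs @ v y # (map v ys @ Ys))"
    proof -
      have "set (map v xs @ v x # v y # (map v ys @ Ys)) \<subseteq> \<XX> M"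
        using True vs [of xs] vs [of ys] v by auto
      then show ?thesis
        using assms(1) const_smooth [of c M] unfolding forms_def by blast
    qed
    then show ?thesis
      unfolding comb [symmetric] by (simp add: fun_eq_iff)
  next
    case False
    then show ?thesis
      using zero [of "map v _"] by (simp del: map_append add: fun_eq_iff)
  qed
  show "\<alpha> (map v (xs @ x # x # ys) @ Ys) = 0 Ys"
  proof (cases "set Ys \<subseteq> \<XX> M")
    case True
    then have "set (map v (xs @ x # x # ys) @ Ys) \<subseteq> \<XX> M"
      using vs [of "xs @ x # x # ys"] by auto
    moreover have "\<not> distinct (map v (xs @ x # x # ys) @ Ys)"
      by simp
    ultimately show ?thesis
      using assms(1) unfolding forms_def by (simp del: map_append)
  next
    case False
    then show ?thesis
      using zero [of "map v _"] by (simp del: map_append)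
  qed
qed

lemma contract_ext_wedge:
  assumes "\<alpha> \<in> \<Omega> M k" "linear v" "\<And>x. v x \<in> \<XX> M"
  shows "contract_ext v (wedge xs) \<alpha> = fold (\<lambda>x. contract (v x)) xs \<alpha>"
  using ext_extend_wedge [OF alternating_contract [OF assms]] by (simp add: contract_ext_def)

definition sgn_factor :: "nat \<Rightarrow> real" (\<open>\<varsigma>\<close>)
  where "\<varsigma> k = - ((-1) ^ (k * (k + 1) div 2))"

definition comomentum_map ::
  "'m manifold \<Rightarrow> nat \<Rightarrow> 'm dform \<Rightarrow> ('g::real_vector \<Rightarrow> 'g \<Rightarrow> 'g) \<Rightarrow> ('g \<Rightarrow> 'm vfield)
     \<Rightarrow> (nat \<Rightarrow> 'g ext \<Rightarrow> 'm dform) \<Rightarrow> bool" where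
  "comomentum_map M n \<omega> br v f \<longleftrightarrow>
     (\<forall>i \<in> {1..n}. \<forall>p \<in> \<Lambda> i. f i p \<in> \<Omega> M (n - i)) \<and>
     (\<forall>i \<in> {1..n}. \<forall>p \<in> \<Lambda> i. \<forall>q \<in> \<Lambda> i. \<forall>c. f i (c *\<^sub>R p + q) = c *\<^sub>R f i p + f i q) \<and>
     (\<forall>p \<in> \<Lambda> 1. f 1 p \<in> hamiltonian_forms M n \<omega>) \<and>
     (\<forall>x. \<d> M (f 1 (wedge [x])) = - contract (v x) \<omega>) \<and>
     (let F = (\<lambda>i. if i \<in> {1..n} then f i else 0) in
       \<forall>k \<in> {1..n + 1}. \<forall>p \<in> \<Lambda> k.
         - F (k - 1) (boundary br p) = \<d> M (F k p) + \<varsigma> k *\<^sub>R contract_ext v p \<omega>)"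

end

theory Submission
  imports Defs
begin

text \<open>
  Since \<open>p\<close> is a cycle, the defining equation of a co-momentum map loses its boundary term and
  reads \<open>d (f\<^sub>k p) = - \<varsigma>(k) \<iota>(v\<^sub>p) \<omega>\<close> (lemma \<open>comomentum_cycle\<close>). As the Lie derivative commutes with \<open>d\<close>
  (lemma \<open>lie_deriv_ext_deriv\<close>), \<open>\<L> v\<^sub>H (f\<^sub>k p)\<close> is closed as soon as \<open>\<L> v\<^sub>H (\<iota>(v\<^sub>p) \<omega>) = 0\<close>. Because of
  \<open>[\<L> X, \<iota> Y] = \<iota> [X, Y]\<close> (lemma \<open>lie_deriv_contract\<close>), the latter follows from two facts:

  \<^item> \<open>\<L> v\<^sub>H \<omega> = 0\<close>, by Cartan's formula, \<open>d \<omega> = 0\<close> and \<open>d (\<iota> v\<^sub>H \<omega>) = - d (d H) = 0\<close>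
    (lemma \<open>hamiltonian_vf_invariance\<close>);
  \<^item> \<open>\<iota> [v\<^sub>H, v\<^sub>x] \<omega> = 0\<close>, since \<open>\<iota> [v\<^sub>x, v\<^sub>H] \<omega> = \<L> v\<^sub>x (\<iota> v\<^sub>H \<omega>) - \<iota> v\<^sub>H (\<L> v\<^sub>x \<omega>) = - d (\<L> v\<^sub>x H) = 0\<close>
    because \<open>H\<close> is locally preserved (lemma \<open>contract_bracket_hamiltonian\<close>).

  Most of the work is the Cartan calculus for forms as alternating maps on lists of derivations. The
  only place where the alternating sums in the formula for \<open>d\<close> are rearranged is Cartan's formula
  (lemma \<open>cartan\<close>). Together with \<open>[\<L> X, \<iota> Y] = \<iota> [X, Y]\<close>, it makes both operators recursive in
  the list of arguments,
  \<open>d \<alpha> (X # Ys) = \<L> X \<alpha> Ys - d (\<iota> X \<alpha>) Ys\<close> and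
  \<open>\<L> X \<alpha> (Y # Ys) = \<L> X (\<iota> Y \<alpha>) Ys - \<alpha> ([X, Y] # Ys)\<close>,
  and every further identity (closure of the forms under \<open>d\<close> and \<open>\<L> X\<close>, \<open>\<L> [X, Y] = [\<L> X, \<L> Y]\<close>,
  \<open>[\<L> X, d] = 0\<close>, \<open>d d = 0\<close>) is an induction over that list in which \<open>\<alpha>\<close> varies with its degree.
\<close>

section \<open>Smooth functions\<close>

text \<open>
  The product rule leaves factors that are not differentiated, so products need that
  differentiability of one order implies that of the order below.
\<close>

lemma Ck_on_Suc_imp_Ck_on: "Ck_on m (Suc k) V f \<Longrightarrow> Ck_on m k V f"
proof (induction k arbitrary: f)
  case (Suc k)
  then show ?case
    by (metis Ck_on.simps(2))
qed simp

lemma Ck_on_lincomb: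
  "Ck_on m k V f \<Longrightarrow> Ck_on m k V g \<Longrightarrow> Ck_on m k V (\<lambda>x. c * f x + g x)"
proof (induction k arbitrary: f g)
  case 0
  then show ?case
    by (auto intro: continuous_map_add continuous_map_real_mult_left)
next
  case (Suc k)
  have "\<exists>h. (\<forall>x\<in>V. ((\<lambda>t. c * f (x(i := t)) + g (x(i := t))) has_real_derivative h x) (at (x i)))
          \<and> Ck_on m k V h" if i: "i < m" for i
  proof -
    obtain f' where f':
      "\<forall>x\<in>V. ((\<lambda>t. f (x(i := t))) has_real_derivative f' x) (at (x i))" "Ck_on m k V f'"
      using Suc.prems(1) i unfolding Ck_on.simps by blast
    obtain g' where g':
      "\<forall>x\<in>V. ((\<lambda>t. g (x(i := t))) has_real_derivative g' x) (at (x i))" "Ck_on m k V g'"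
      using Suc.prems(2) i unfolding Ck_on.simps by blast
    have "Ck_on m k V (\<lambda>x. c * f' x + g' x)"
      using f' g' by (intro Suc.IH)
    moreover have "\<forall>x\<in>V. ((\<lambda>t. c * f (x(i := t)) + g (x(i := t))) has_real_derivative
                      c * f' x + g' x) (at (x i))"
      using f'(1) g'(1) by (intro ballI DERIV_add DERIV_cmult) simp_all
    ultimately show ?thesis
      by (intro exI [of _ "\<lambda>x. c * f' x + g' x"]) simp
  qed
  with Suc.prems show ?case
    by (auto intro: continuous_map_add continuous_map_real_mult_left)
qed

lemma Ck_on_mult:
  "Ck_on m k V f \<Longrightarrow> Ck_on m k V g \<Longrightarrow> Ck_on m k V (\<lambda>x. f x * g x)"
proof (induction k arbitrary: f g)
  case 0
  then show ?case
    by (auto intro: continuous_map_real_mult)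
next
  case (Suc k)
  have "\<exists>h. (\<forall>x\<in>V. ((\<lambda>t. f (x(i := t)) * g (x(i := t))) has_real_derivative h x) (at (x i)))
          \<and> Ck_on m k V h" if i: "i < m" for i
  proof -
    obtain f' where f':
      "\<forall>x\<in>V. ((\<lambda>t. f (x(i := t))) has_real_derivative f' x) (at (x i))" "Ck_on m k V f'"
      using Suc.prems(1) i unfolding Ck_on.simps by blast
    obtain g' where g':
      "\<forall>x\<in>V. ((\<lambda>t. g (x(i := t))) has_real_derivative g' x) (at (x i))" "Ck_on m k V g'"
      using Suc.prems(2) i unfolding Ck_on.simps by blast
    have "Ck_on m k V (\<lambda>x. 1 * (f' x * g x) + f x * g' x)"
      using f'(2) g'(2) Suc.prems [THEN Ck_on_Suc_imp_Ck_on] by (intro Ck_on_lincomb Suc.IH)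
    moreover have "\<forall>x\<in>V. ((\<lambda>t. f (x(i := t)) * g (x(i := t))) has_real_derivative
                      1 * (f' x * g x) + f x * g' x) (at (x i))"
    proof
      fix x assume "x \<in> V"
      with f'(1) g'(1) show "((\<lambda>t. f (x(i := t)) * g (x(i := t))) has_real_derivative
          1 * (f' x * g x) + f x * g' x) (at (x i))"
        using DERIV_mult [of "\<lambda>t. f (x(i := t))" "f' x" "x i" UNIV "\<lambda>t. g (x(i := t))" "g' x"]
        by (simp add: mult.commute)
    qed
    ultimately show ?thesis
      by (intro exI [of _ "\<lambda>x. 1 * (f' x * g x) + f x * g' x"]) simp
  qed
  with Suc.prems show ?case
    by (auto intro: continuous_map_real_mult)
qed

lemma fun_mult_scaleR: "f * (c *\<^sub>R g) = c *\<^sub>R (f * g)" for f g :: "'a \<Rightarrow> real"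
  by (simp add: fun_eq_iff)

lemma smooth_lincomb: "f \<in> C\<^sup>\<infinity> M \<Longrightarrow> g \<in> C\<^sup>\<infinity> M \<Longrightarrow> c *\<^sub>R f + g \<in> C\<^sup>\<infinity> M"
  by (auto simp: smooth_functions_def smooth_on_def intro!: Ck_on_lincomb)

lemma smooth_mult: "f \<in> C\<^sup>\<infinity> M \<Longrightarrow> g \<in> C\<^sup>\<infinity> M \<Longrightarrow> f * g \<in> C\<^sup>\<infinity> M"
  by (auto simp: smooth_functions_def smooth_on_def intro!: Ck_on_mult)

lemma smooth_zero: "0 \<in> C\<^sup>\<infinity> M"
  using const_smooth [of 0 M] by (simp add: zero_fun_def)

lemma subspace_smooth: "subspace (C\<^sup>\<infinity> M)"
proof (rule subspaceI)
  show "x + y \<in> C\<^sup>\<infinity> M" if "x \<in> C\<^sup>\<infinity> M" "y \<in> C\<^sup>\<infinity> M" for x y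
    using smooth_lincomb [OF that, of 1] by simp
  show "c *\<^sub>R x \<in> C\<^sup>\<infinity> M" if "x \<in> C\<^sup>\<infinity> M" for c x
    using smooth_lincomb [OF that smooth_zero, of c] by simp
qed (rule smooth_zero)

lemmas smooth_add = subspace_add [OF subspace_smooth]
  and smooth_diff = subspace_diff [OF subspace_smooth]
  and smooth_uminus = subspace_neg [OF subspace_smooth]
  and smooth_scaleR = subspace_scale [OF subspace_smooth]
  and smooth_sum = subspace_sum [OF subspace_smooth]

lemmas smooth_intros = smooth_zero smooth_add smooth_diff smooth_uminus smooth_scaleR smooth_sum
  smooth_mult


section \<open>The Lie algebra of vector fields\<close>

lemma vf_smooth: "X \<in> \<XX> M \<Longrightarrow> X f \<in> C\<^sup>\<infinity> M"
  by (cases "f \<in> C\<^sup>\<infinity> M") (auto simp: vector_fields_def smooth_zero)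

lemma vf_non_smooth: "X \<in> \<XX> M \<Longrightarrow> f \<notin> C\<^sup>\<infinity> M \<Longrightarrow> X f = 0"
  by (auto simp: vector_fields_def)

lemma vf_lincomb:
  "X \<in> \<XX> M \<Longrightarrow> f \<in> C\<^sup>\<infinity> M \<Longrightarrow> g \<in> C\<^sup>\<infinity> M \<Longrightarrow> X (c *\<^sub>R f + g) = c *\<^sub>R X f + X g"
  by (auto simp: vector_fields_def)

lemma vf_mult:
  "X \<in> \<XX> M \<Longrightarrow> f \<in> C\<^sup>\<infinity> M \<Longrightarrow> g \<in> C\<^sup>\<infinity> M \<Longrightarrow> X (f * g) = f * X g + X f * g"
  by (auto simp: vector_fields_def)

lemma vf_add: "X \<in> \<XX> M \<Longrightarrow> f \<in> C\<^sup>\<infinity> M \<Longrightarrow> g \<in> C\<^sup>\<infinity> M \<Longrightarrow> X (f + g) = X f + X g"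
  using vf_lincomb [of X M f g 1] by simp

lemma vf_zero: "X \<in> \<XX> M \<Longrightarrow> X 0 = 0"
  by (metis add_0 add_cancel_right_right smooth_zero vf_add)

lemma vf_scaleR: "X \<in> \<XX> M \<Longrightarrow> f \<in> C\<^sup>\<infinity> M \<Longrightarrow> X (c *\<^sub>R f) = c *\<^sub>R X f"
  by (metis add.right_neutral smooth_zero vf_lincomb vf_zero)

lemma vf_diff: "X \<in> \<XX> M \<Longrightarrow> f \<in> C\<^sup>\<infinity> M \<Longrightarrow> g \<in> C\<^sup>\<infinity> M \<Longrightarrow> X (f - g) = X f - X g"
  using vf_lincomb [of X M g f "-1"] by (simp add: smooth_intros)

lemmas vf_simps = vf_add vf_zero vf_scaleR vf_diff vf_mult vf_smooth

lemma vector_fieldsI: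
  assumes "\<And>f. f \<in> C\<^sup>\<infinity> M \<Longrightarrow> X f \<in> C\<^sup>\<infinity> M"
    and "\<And>f. f \<notin> C\<^sup>\<infinity> M \<Longrightarrow> X f = 0"
    and "\<And>f g c. f \<in> C\<^sup>\<infinity> M \<Longrightarrow> g \<in> C\<^sup>\<infinity> M \<Longrightarrow> X (c *\<^sub>R f + g) = c *\<^sub>R X f + X g"
    and "\<And>f g. f \<in> C\<^sup>\<infinity> M \<Longrightarrow> g \<in> C\<^sup>\<infinity> M \<Longrightarrow> X (f * g) = f * X g + X f * g"
  shows "X \<in> \<XX> M"
  using assms by (auto simp: vector_fields_def)

lemma vf_combination:
  assumes "X \<in> \<XX> M" "Y \<in> \<XX> M" "g \<in> C\<^sup>\<infinity> M"
  shows "(\<lambda>f. g * X f + Y f) \<in> \<XX> M"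
  by (rule vector_fieldsI)
    (use assms in \<open>simp_all add: vf_simps [of X M] vf_simps [of Y M]
      vf_non_smooth [of X M] vf_non_smooth [of Y M] smooth_intros fun_mult_scaleR algebra_simps\<close>)

lemma vf_zero_closed: "0 \<in> \<XX> M"
  by (rule vector_fieldsI) (simp_all add: smooth_zero)

lemma vf_plus: "X \<in> \<XX> M \<Longrightarrow> Y \<in> \<XX> M \<Longrightarrow> X + Y \<in> \<XX> M"
  using vf_combination [of X M Y "\<lambda>_. 1"] const_smooth [of 1 M]
  by (simp add: plus_fun_def times_fun_def)

lemma vf_uminus: "X \<in> \<XX> M \<Longrightarrow> - X \<in> \<XX> M"
  using vf_combination [of X M 0 "\<lambda>_. -1"] const_smooth [of "-1" M]
  by (simp add: vf_zero_closed plus_fun_def times_fun_def fun_Compl_def)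

lemma vf_bracket_closed:
  assumes "X \<in> \<XX> M" "Y \<in> \<XX> M"
  shows "vf_bracket X Y \<in> \<XX> M"
  by (rule vector_fieldsI)
    (use assms in \<open>simp_all add: vf_bracket_def vf_simps [of X M] vf_simps [of Y M]
      vf_non_smooth [of X M] vf_non_smooth [of Y M] smooth_intros algebra_simps\<close>)

lemma vf_bracket_skew: "vf_bracket X Y = - vf_bracket Y X"
  by (simp add: vf_bracket_def fun_eq_iff)

lemma vf_bracket_jacobi:
  assumes "X \<in> \<XX> M" "Y \<in> \<XX> M" "Z \<in> \<XX> M"
  shows "vf_bracket (vf_bracket X Y) Z = vf_bracket X (vf_bracket Y Z) - vf_bracket Y (vf_bracket X Z)"
  using assms
  by (intro ext) (simp add: vf_bracket_def vf_simps [of X M] vf_simps [of Y M] vf_simps [of Z M])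

text \<open>
  The Leibniz rule \<open>[X, g Y] = X(g) Y + g [X, Y]\<close>, in the shape of two nested combinations so that
  function-linearity of forms can be applied twice.
\<close>

lemma vf_bracket_combination:
  assumes "X \<in> \<XX> M" "Y \<in> \<XX> M" "Z \<in> \<XX> M" "g \<in> C\<^sup>\<infinity> M"
  shows "vf_bracket X (\<lambda>f. g * Y f + Z f) =
    (\<lambda>f. X g * Y f + (\<lambda>f. g * vf_bracket X Y f + vf_bracket X Z f) f)"
  using assms
  by (intro ext)
    (simp add: vf_bracket_def vf_simps [of X M] vf_simps [of Y M] vf_simps [of Z M]
      smooth_intros algebra_simps)


section \<open>Differential forms\<close>

lemma form_smooth: "\<alpha> \<in> \<Omega> M k \<Longrightarrow> \<alpha> Xs \<in> C\<^sup>\<infinity> M"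
  by (cases "length Xs = k \<and> set Xs \<subseteq> \<XX> M") (auto simp: forms_def smooth_zero)

lemma form_undefined: "\<alpha> \<in> \<Omega> M k \<Longrightarrow> \<not> (length Xs = k \<and> set Xs \<subseteq> \<XX> M) \<Longrightarrow> \<alpha> Xs = 0"
  by (auto simp: forms_def)

lemma form_combination:
  assumes "\<alpha> \<in> \<Omega> M k" "X \<in> \<XX> M" "Y \<in> \<XX> M" "g \<in> C\<^sup>\<infinity> M"
  shows "\<alpha> (Xs @ (\<lambda>f. g * X f + Y f) # Ys) = g * \<alpha> (Xs @ X # Ys) + \<alpha> (Xs @ Y # Ys)"
proof (cases "set (Xs @ Ys) \<subseteq> \<XX> M")
  case True
  then have "set (Xs @ X # Y # Ys) \<subseteq> \<XX> M"
    using assms by auto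
  with assms show ?thesis
    unfolding forms_def by blast
next
  case False
  then show ?thesis
    using form_undefined [OF assms(1)] by auto
qed

lemma form_not_distinct: "\<alpha> \<in> \<Omega> M k \<Longrightarrow> \<not> distinct Xs \<Longrightarrow> \<alpha> Xs = 0"
  by (cases "set Xs \<subseteq> \<XX> M") (auto simp: forms_def)

lemma form_add:
  assumes "\<alpha> \<in> \<Omega> M k" "X \<in> \<XX> M" "Y \<in> \<XX> M"
  shows "\<alpha> (Xs @ (X + Y) # Ys) = \<alpha> (Xs @ X # Ys) + \<alpha> (Xs @ Y # Ys)"
proof -
  have "(\<lambda>f. (\<lambda>_. 1) * X f + Y f) = X + Y"
    by (simp add: fun_eq_iff)
  then show ?thesis
    using form_combination [OF assms const_smooth [of 1], of Xs Ys]
    by (simp only:) (simp add: fun_eq_iff)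
qed

lemma form_uminus:
  assumes "\<alpha> \<in> \<Omega> M k" "X \<in> \<XX> M"
  shows "\<alpha> (Xs @ (- X) # Ys) = - \<alpha> (Xs @ X # Ys)"
proof -
  have "\<alpha> (Xs @ 0 # Ys) = \<alpha> (Xs @ 0 # Ys) + \<alpha> (Xs @ 0 # Ys)"
    using form_add [OF assms(1) vf_zero_closed vf_zero_closed] by simp
  moreover have "\<alpha> (Xs @ 0 # Ys) = \<alpha> (Xs @ (- X) # Ys) + \<alpha> (Xs @ X # Ys)"
    using form_add [OF assms(1) vf_uminus [OF assms(2)] assms(2)] by simp
  ultimately show ?thesis
    by (metis add_cancel_right_right eq_neg_iff_add_eq_0)
qed

lemma form_diff:
  assumes "\<alpha> \<in> \<Omega> M k" "X \<in> \<XX> M" "Y \<in> \<XX> M"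
  shows "\<alpha> (Xs @ (X - Y) # Ys) = \<alpha> (Xs @ X # Ys) - \<alpha> (Xs @ Y # Ys)"
  by (simp only: diff_conv_add_uminus form_add [OF assms(1,2) vf_uminus [OF assms(3)]]
      form_uminus [OF assms(1,3)])

text \<open>
  Polarisation: a form vanishes on lists with \<open>X + Y\<close> in both places. When \<open>X\<close> or \<open>Y\<close> is not a vector
  field, both sides have the default value 0, so that the rule is unconditional.
\<close>

lemma form_swap:
  assumes "\<alpha> \<in> \<Omega> M k"
  shows "\<alpha> (Xs @ X # Y # Ys) = - \<alpha> (Xs @ Y # X # Ys)"
proof (cases "X \<in> \<XX> M \<and> Y \<in> \<XX> M")
  case True
  then have X: "X \<in> \<XX> M" and Y: "Y \<in> \<XX> M" and XY: "X + Y \<in> \<XX> M"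
    by (auto intro: vf_plus)
  have split: "\<alpha> (Xs @ Z # (X + Y) # Ys) = \<alpha> (Xs @ Z # X # Ys) + \<alpha> (Xs @ Z # Y # Ys)" for Z
    using form_add [OF assms X Y, of "Xs @ [Z]" Ys] by simp
  have diag: "\<alpha> (Xs @ Z # Z # Ys) = 0" for Z
    using form_not_distinct [OF assms, of "Xs @ Z # Z # Ys"] by simp
  have "0 = \<alpha> (Xs @ (X + Y) # (X + Y) # Ys)"
    by (simp only: diag)
  also have "\<dots> = \<alpha> (Xs @ X # Y # Ys) + \<alpha> (Xs @ Y # X # Ys)"
    by (simp only: form_add [OF assms X Y] split diag add_0_left add_0_right)
  finally show ?thesis
    by (simp only: eq_neg_iff_add_eq_0)
next
  case False
  then show ?thesis
    using form_undefined [OF assms] by auto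
qed

text \<open>
  The Koszul formula for \<open>d\<close> places brackets at the front of the argument list, the Lie derivative
  leaves them in place; this is the conversion between the two.
\<close>

lemma skew_move_to_front:
  fixes \<alpha> :: "'a list \<Rightarrow> 'b::real_vector"
  assumes swap: "\<And>Xs X Y Ys. \<alpha> (Xs @ X # Y # Ys) = - \<alpha> (Xs @ Y # X # Ys)"
  shows "\<alpha> (Xs @ X # Ys) = (-1) ^ length Xs *\<^sub>R \<alpha> (X # Xs @ Ys)"
proof (induction Xs arbitrary: Ys rule: rev_induct)
  case (snoc Z Xs)
  then show ?case
    using swap [of Xs Z X Ys] by simp
qed simp

text \<open>
  Skew-symmetry under adjacent transpositions moves any argument to the front, so function-linearity
  is only required there. In this form the criterion suits recursively described maps.
\<close>

lemma formsI:
  assumes smooth: "\<And>Xs. length Xs = k \<Longrightarrow> set Xs \<subseteq> \<XX> M \<Longrightarrow> \<alpha> Xs \<in> C\<^sup>\<infinity> M"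
    and undefined: "\<And>Xs. \<not> (length Xs = k \<and> set Xs \<subseteq> \<XX> M) \<Longrightarrow> \<alpha> Xs = 0"
    and swap: "\<And>Xs X Y Ys. set (Xs @ X # Y # Ys) \<subseteq> \<XX> M \<Longrightarrow> \<alpha> (Xs @ X # Y # Ys) = - \<alpha> (Xs @ Y # X # Ys)"
    and head: "\<And>X Y Ys g. g \<in> C\<^sup>\<infinity> M \<Longrightarrow> set (X # Y # Ys) \<subseteq> \<XX> M \<Longrightarrow>
      \<alpha> ((\<lambda>f. g * X f + Y f) # Ys) = g * \<alpha> (X # Ys) + \<alpha> (Y # Ys)"
  shows "\<alpha> \<in> \<Omega> M k"
proof -
  have "\<alpha> (Xs @ X # Y # Ys) = - \<alpha> (Xs @ Y # X # Ys)" for Xs X Y Ys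
  proof (cases "set (Xs @ X # Y # Ys) \<subseteq> \<XX> M")
    case False
    then show ?thesis
      by (auto simp: undefined)
  qed (rule swap)
  note front = skew_move_to_front [of \<alpha>, OF this]
  have "\<alpha> (Xs @ (\<lambda>f. g * X f + Y f) # Ys) = g * \<alpha> (Xs @ X # Ys) + \<alpha> (Xs @ Y # Ys)"
    if "g \<in> C\<^sup>\<infinity> M" "set (Xs @ X # Y # Ys) \<subseteq> \<XX> M" for Xs X Y Ys g
    using that by (simp add: front [of Xs] head fun_mult_scaleR scaleR_add_right)
  moreover have "\<alpha> Xs = 0" if nd: "set Xs \<subseteq> \<XX> M" "\<not> distinct Xs" for Xs
  proof -
    obtain As Bs Cs X where Xs: "Xs = As @ [X] @ Bs @ [X] @ Cs"
      using not_distinct_decomp [OF nd(2)] by blast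
    have "\<alpha> (As @ X # X # Bs @ Cs) = - \<alpha> (As @ X # X # Bs @ Cs)"
      using nd Xs by (intro swap) auto
    then have "\<alpha> (As @ X # X # Bs @ Cs) = 0"
      by (simp add: fun_eq_iff)
    then show ?thesis
      using front [of "As @ X # Bs" X Cs] front [of "As @ [X]" X "Bs @ Cs"]
      by (simp add: Xs)
  qed
  ultimately show ?thesis
    using smooth undefined by (simp add: forms_def)
qed

lemma subspace_forms: "subspace (\<Omega> M k)"
proof (rule subspaceI)
  show "0 \<in> \<Omega> M k"
    by (rule formsI) (simp_all add: smooth_zero)
  show "\<alpha> + \<beta> \<in> \<Omega> M k" if \<alpha>: "\<alpha> \<in> \<Omega> M k" and \<beta>: "\<beta> \<in> \<Omega> M k" for \<alpha> \<beta>
  proof (rule formsI)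
    show "(\<alpha> + \<beta>) (Xs @ X # Y # Ys) = - (\<alpha> + \<beta>) (Xs @ Y # X # Ys)" for Xs X Y Ys
      using form_swap [OF \<alpha>, of Xs X Y Ys] form_swap [OF \<beta>, of Xs X Y Ys] by simp
    show "(\<alpha> + \<beta>) ((\<lambda>f. g * X f + Y f) # Ys) = g * (\<alpha> + \<beta>) (X # Ys) + (\<alpha> + \<beta>) (Y # Ys)"
      if "g \<in> C\<^sup>\<infinity> M" "set (X # Y # Ys) \<subseteq> \<XX> M" for X Y Ys g
      using that form_combination [OF \<alpha>, of X Y g "[]"] form_combination [OF \<beta>, of X Y g "[]"]
      by (simp add: algebra_simps)
  qed (simp_all add: form_smooth [OF \<alpha>] form_smooth [OF \<beta>] form_undefined [OF \<alpha>]
      form_undefined [OF \<beta>] smooth_intros)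
  show "c *\<^sub>R \<alpha> \<in> \<Omega> M k" if \<alpha>: "\<alpha> \<in> \<Omega> M k" for c \<alpha>
  proof (rule formsI)
    show "(c *\<^sub>R \<alpha>) (Xs @ X # Y # Ys) = - (c *\<^sub>R \<alpha>) (Xs @ Y # X # Ys)" for Xs X Y Ys
      using form_swap [OF \<alpha>, of Xs X Y Ys] by simp
    show "(c *\<^sub>R \<alpha>) ((\<lambda>f. g * X f + Y f) # Ys) = g * (c *\<^sub>R \<alpha>) (X # Ys) + (c *\<^sub>R \<alpha>) (Y # Ys)"
      if "g \<in> C\<^sup>\<infinity> M" "set (X # Y # Ys) \<subseteq> \<XX> M" for X Y Ys g
      using that form_combination [OF \<alpha>, of X Y g "[]"]
      by (simp add: fun_mult_scaleR scaleR_add_right)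
  qed (simp_all add: form_smooth [OF \<alpha>] form_undefined [OF \<alpha>] smooth_intros)
qed

text \<open>
  In degree 0 the contraction is the zero form, which belongs to every degree, hence also to the
  degree \<open>0 - 1 = 0\<close>. Most inductions over argument lists can therefore contract without a case distinction.
\<close>

lemma contract_form:
  assumes "\<alpha> \<in> \<Omega> M k" "X \<in> \<XX> M"
  shows "contract X \<alpha> \<in> \<Omega> M (k - 1)"
proof (cases k)
  case 0
  then have "contract X \<alpha> = 0"
    using form_undefined [OF assms(1)] by (auto simp: contract_def fun_eq_iff)
  then show ?thesis
    by (simp add: subspace_0 [OF subspace_forms])
next
  case (Suc j)
  show ?thesis
  proof (rule formsI)
    show "contract X \<alpha> (Xs @ Y # Z # Ys) = - contract X \<alpha> (Xs @ Z # Y # Ys)" for Xs Y Z Ys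
      using form_swap [OF assms(1), of "X # Xs" Y Z Ys] by (simp add: contract_def)
    show "contract X \<alpha> ((\<lambda>f. g * Y f + Z f) # Ys) = g * contract X \<alpha> (Y # Ys) + contract X \<alpha> (Z # Ys)"
      if "g \<in> C\<^sup>\<infinity> M" "set (Y # Z # Ys) \<subseteq> \<XX> M" for Y Z Ys g
      using form_combination [OF assms(1) _ _ that(1), of Y Z "[X]"] that(2) by (simp add: contract_def)
  qed (use assms Suc in \<open>auto simp: contract_def form_smooth form_undefined\<close>)
qed

lemma contract_swap: "\<alpha> \<in> \<Omega> M k \<Longrightarrow> contract X (contract Y \<alpha>) = - contract Y (contract X \<alpha>)"
  by (intro ext) (use form_swap [of \<alpha> M k "[]" Y X] in \<open>simp add: contract_def\<close>)


section \<open>Recursive description of the Lie derivative and the exterior derivative\<close>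

lemma lie_deriv_Nil [simp]: "\<L> M X \<alpha> [] = X (\<alpha> [])"
  by (simp add: lie_deriv_def)

text \<open>
  The term of the Lie derivative in which the bracket hits the first argument is split off; this is
  \<open>\<iota> Y (\<L> X \<alpha>) = \<L> X (\<iota> Y \<alpha>) - \<iota> [X, Y] \<alpha>\<close> evaluated at a list.
\<close>

lemma lie_deriv_Cons:
  assumes "Y \<in> \<XX> M" "set Ys \<subseteq> \<XX> M"
  shows "\<L> M X \<alpha> (Y # Ys) = \<L> M X (contract Y \<alpha>) Ys - \<alpha> (vf_bracket X Y # Ys)"
  using assms by (simp add: lie_deriv_def contract_def sum.lessThan_Suc_shift del: sum.lessThan_Suc)

lemma lie_deriv_lincomb:
  assumes "X \<in> \<XX> M" "\<And>Ys. \<alpha> Ys \<in> C\<^sup>\<infinity> M" "\<And>Ys. \<beta> Ys \<in> C\<^sup>\<infinity> M"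
  shows "\<L> M X (c *\<^sub>R \<alpha> + \<beta>) = c *\<^sub>R \<L> M X \<alpha> + \<L> M X \<beta>"
proof
  fix Ys
  show "\<L> M X (c *\<^sub>R \<alpha> + \<beta>) Ys = (c *\<^sub>R \<L> M X \<alpha> + \<L> M X \<beta>) Ys"
    using assms
    by (simp add: lie_deriv_def vf_lincomb sum.distrib scaleR_sum_right scaleR_add_right scaleR_diff_right)
      (simp add: fun_eq_iff)
qed

lemma ext_deriv_lincomb:
  assumes "\<And>Ys. \<alpha> Ys \<in> C\<^sup>\<infinity> M" "\<And>Ys. \<beta> Ys \<in> C\<^sup>\<infinity> M"
  shows "\<d> M (c *\<^sub>R \<alpha> + \<beta>) = c *\<^sub>R \<d> M \<alpha> + \<d> M \<beta>"
proof
  fix Xs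
  show "\<d> M (c *\<^sub>R \<alpha> + \<beta>) Xs = (c *\<^sub>R \<d> M \<alpha> + \<d> M \<beta>) Xs"
  proof (cases "set Xs \<subseteq> \<XX> M")
    case True
    then have "(Xs ! i) (c *\<^sub>R \<alpha> Ys + \<beta> Ys) = c *\<^sub>R (Xs ! i) (\<alpha> Ys) + (Xs ! i) (\<beta> Ys)"
      if "i < length Xs" for i Ys
      using assms that by (intro vf_lincomb [of _ M]) (auto simp: subset_iff)
    with True show ?thesis
      by (simp add: ext_deriv_def sum.distrib scaleR_sum_right scaleR_add_right mult.commute)
  qed (simp add: ext_deriv_def)
qed

lemma ext_deriv_Nil [simp]: "\<d> M \<alpha> [] = 0"
  by (simp add: ext_deriv_def)

lemma nths_remove: "nths xs (- {i}) = take i xs @ drop (Suc i) xs"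
proof (induction xs arbitrary: i)
  case (Cons x xs)
  have "{j. j \<noteq> k} = - {k}" for k :: nat
    by auto
  with Cons show ?case
    by (cases i) (simp_all add: nths_Cons nths_all)
qed simp

text \<open>
  In the Koszul formula for \<open>d \<alpha> (X # Ys)\<close>, the terms that differentiate along \<open>X\<close> or contain a bracket
  with \<open>X\<close> form \<open>\<L> X \<alpha> Ys\<close>, once the brackets are moved from the front into their places. In the other
  terms \<open>X\<close> is a mere argument; they form \<open>- d (\<iota> X \<alpha>) Ys\<close>, as all positions are shifted by one and as
  \<open>X\<close> has to pass the bracket in the second sum.
\<close>

lemma cartan:
  assumes \<alpha>: "\<alpha> \<in> \<Omega> M k" and X: "X \<in> \<XX> M"
  shows "contract X (\<d> M \<alpha>) = \<L> M X \<alpha> - \<d> M (contract X \<alpha>)"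
proof
  fix Ys
  show "contract X (\<d> M \<alpha>) Ys = (\<L> M X \<alpha> - \<d> M (contract X \<alpha>)) Ys"
  proof (cases "set Ys \<subseteq> \<XX> M")
    case True
    let ?n = "length Ys"
    \<comment> \<open>The sign of moving a bracket to position \<open>j\<close> cancels the sign in the Koszul formula.\<close>
    have update: "(-1) ^ j *\<^sub>R \<alpha> (A # nths Ys (- {j})) = \<alpha> (Ys[j := A])" if "j < ?n" for A j
      using that skew_move_to_front [of \<alpha> "take j Ys" A "drop (Suc j) Ys", OF form_swap [OF \<alpha>]]
      by (simp add: nths_remove upd_conv_take_nth_drop)
    have shift: "{m. m \<noteq> i} = - {i}" "{m. m \<noteq> i \<and> m \<noteq> j} = - {i, j}" for i j :: nat
      by auto
    have swap: "\<alpha> (A # X # Zs) = - \<alpha> (X # A # Zs)" for A Zs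
      using form_swap [OF \<alpha>, of "[]" A X Zs] by simp
    have "contract X (\<d> M \<alpha>) Ys =
        X (\<alpha> Ys) - (\<Sum>i<?n. (-1) ^ i *\<^sub>R (Ys ! i) (\<alpha> (X # nths Ys (- {i}))))
        - (\<Sum>j<?n. (-1) ^ j *\<^sub>R \<alpha> (vf_bracket X (Ys ! j) # nths Ys (- {j})))
        + (\<Sum>j<?n. \<Sum>i<j. (-1) ^ (i + j) *\<^sub>R \<alpha> (vf_bracket (Ys ! i) (Ys ! j) # X # nths Ys (- {i, j})))"
      using True X
      by (simp add: contract_def ext_deriv_def sum.lessThan_Suc_shift nths_Cons nths_all shift
          sum_negf sum.distrib sum_subtractf
          del: sum.lessThan_Suc)
    also have "\<dots> = \<L> M X \<alpha> Ys - \<d> M (contract X \<alpha>) Ys"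
      using True by (simp add: lie_deriv_def ext_deriv_def contract_def update swap sum_negf)
    finally show ?thesis
      by simp
  next
    case False
    then show ?thesis
      by (simp add: contract_def ext_deriv_def lie_deriv_def)
  qed
qed

lemma ext_deriv_Cons:
  assumes "\<alpha> \<in> \<Omega> M k" "X \<in> \<XX> M"
  shows "\<d> M \<alpha> (X # Ys) = \<L> M X \<alpha> Ys - \<d> M (contract X \<alpha>) Ys"
  using fun_cong [OF cartan [OF assms], of Ys] by (simp add: contract_def)

lemma lie_deriv_diff:
  assumes "X \<in> \<XX> M" "\<And>Ys. \<alpha> Ys \<in> C\<^sup>\<infinity> M" "\<And>Ys. \<beta> Ys \<in> C\<^sup>\<infinity> M"
  shows "\<L> M X (\<alpha> - \<beta>) = \<L> M X \<alpha> - \<L> M X \<beta>"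
  using lie_deriv_lincomb [OF assms(1,3,2), of "-1"] by simp

lemma lie_deriv_zero: "X \<in> \<XX> M \<Longrightarrow> \<L> M X 0 = 0"
  by (intro ext) (simp add: lie_deriv_def vf_zero)

lemma lie_deriv_scaleR:
  assumes "X \<in> \<XX> M" "\<And>Ys. \<alpha> Ys \<in> C\<^sup>\<infinity> M"
  shows "\<L> M X (c *\<^sub>R \<alpha>) = c *\<^sub>R \<L> M X \<alpha>"
  using lie_deriv_lincomb [of X M \<alpha> 0 c] assms by (simp add: smooth_zero lie_deriv_zero)

lemma lie_deriv_uminus:
  assumes "X \<in> \<XX> M" "\<And>Ys. \<alpha> Ys \<in> C\<^sup>\<infinity> M"
  shows "\<L> M X (- \<alpha>) = - \<L> M X \<alpha>"
  using lie_deriv_scaleR [OF assms, of "-1"] by simp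

lemma ext_deriv_diff:
  assumes "\<And>Ys. \<alpha> Ys \<in> C\<^sup>\<infinity> M" "\<And>Ys. \<beta> Ys \<in> C\<^sup>\<infinity> M"
  shows "\<d> M (\<alpha> - \<beta>) = \<d> M \<alpha> - \<d> M \<beta>"
  using ext_deriv_lincomb [OF assms(2,1), of "-1"] by simp

lemma ext_deriv_zero: "\<d> M 0 = 0"
  using ext_deriv_diff [of 0 M 0] by (simp add: smooth_zero)

lemma ext_deriv_uminus:
  assumes "\<And>Ys. \<alpha> Ys \<in> C\<^sup>\<infinity> M"
  shows "\<d> M (- \<alpha>) = - \<d> M \<alpha>"
  using ext_deriv_diff [of 0 M \<alpha>] assms by (simp add: smooth_zero ext_deriv_zero)

lemma lie_deriv_smooth:
  "X \<in> \<XX> M \<Longrightarrow> (\<And>Ys. \<alpha> Ys \<in> C\<^sup>\<infinity> M) \<Longrightarrow> \<L> M X \<alpha> Ys \<in> C\<^sup>\<infinity> M"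
  by (cases "set Ys \<subseteq> \<XX> M") (simp_all add: lie_deriv_def smooth_intros vf_smooth)

text \<open>
  This is \<open>\<L> X (g \<alpha> + \<beta>) = X(g) \<alpha> + g \<L> X \<alpha> + \<L> X \<beta>\<close>; its first term is cancelled in
  \<open>lie_deriv_form\<close> by the one from the Leibniz rule for brackets.
\<close>

lemma lie_deriv_combination:
  assumes "X \<in> \<XX> M" "\<And>Ys. \<alpha> Ys \<in> C\<^sup>\<infinity> M" "\<And>Ys. \<beta> Ys \<in> C\<^sup>\<infinity> M" "g \<in> C\<^sup>\<infinity> M" "set Ys \<subseteq> \<XX> M"
  shows "\<L> M X (\<lambda>Zs. g * \<alpha> Zs + \<beta> Zs) Ys = X g * \<alpha> Ys + g * \<L> M X \<alpha> Ys + \<L> M X \<beta> Ys"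
  using assms
  by (simp add: lie_deriv_def vf_add vf_mult smooth_mult sum.distrib sum_distrib_left algebra_simps)
    (simp add: fun_eq_iff)

text \<open>
  Arguments in front of the transposed pair are contracted away one by one. At the head, both entries
  are contracted, and the two bracket terms exchange their roles under the transposition.
\<close>

lemma lie_deriv_skew:
  assumes "\<alpha> \<in> \<Omega> M k" "X \<in> \<XX> M" "set (Xs @ Y # Z # Ys) \<subseteq> \<XX> M"
  shows "\<L> M X \<alpha> (Xs @ Y # Z # Ys) = - \<L> M X \<alpha> (Xs @ Z # Y # Ys)"
  using assms
proof (induction Xs arbitrary: \<alpha> k)
  case Nil
  have "\<L> M X (contract Z (contract Y \<alpha>)) = - \<L> M X (contract Y (contract Z \<alpha>))"
    using contract_swap [OF Nil(1), of Z Y] lie_deriv_uminus [OF Nil(2), of "contract Y (contract Z \<alpha>)"]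
    by (simp add: contract_def form_smooth [OF Nil(1)])
  moreover have "\<alpha> (vf_bracket X Y # Z # Ys) = - \<alpha> (Z # vf_bracket X Y # Ys)"
    "\<alpha> (vf_bracket X Z # Y # Ys) = - \<alpha> (Y # vf_bracket X Z # Ys)"
    using form_swap [OF Nil(1), of "[]" "vf_bracket X Y" Z Ys]
      form_swap [OF Nil(1), of "[]" "vf_bracket X Z" Y Ys] by simp_all
  ultimately show ?case
    using Nil by (simp add: lie_deriv_Cons) (simp add: contract_def fun_eq_iff)
next
  case (Cons W Xs)
  have "\<alpha> (vf_bracket X W # Xs @ Y # Z # Ys) = - \<alpha> (vf_bracket X W # Xs @ Z # Y # Ys)"
    using form_swap [OF Cons.prems(1), of "vf_bracket X W # Xs" Y Z Ys] by simp
  moreover have "\<L> M X (contract W \<alpha>) (Xs @ Y # Z # Ys) = - \<L> M X (contract W \<alpha>) (Xs @ Z # Y # Ys)"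
    using Cons.prems by (intro Cons.IH [OF contract_form]) auto
  ultimately show ?case
    using Cons.prems by (simp add: lie_deriv_Cons)
qed

lemma lie_deriv_form:
  assumes \<alpha>: "\<alpha> \<in> \<Omega> M k" and X: "X \<in> \<XX> M"
  shows "\<L> M X \<alpha> \<in> \<Omega> M k"
proof (rule formsI)
  show "\<L> M X \<alpha> Xs \<in> C\<^sup>\<infinity> M" for Xs
    by (intro lie_deriv_smooth X form_smooth [OF \<alpha>])
  show "\<L> M X \<alpha> Xs = 0" if "\<not> (length Xs = k \<and> set Xs \<subseteq> \<XX> M)" for Xs
    using that by (auto simp: lie_deriv_def form_undefined [OF \<alpha>] vf_zero [OF X])
  show "\<L> M X \<alpha> (Xs @ Y # Z # Ys) = - \<L> M X \<alpha> (Xs @ Z # Y # Ys)"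
    if "set (Xs @ Y # Z # Ys) \<subseteq> \<XX> M" for Xs Y Z Ys
    using lie_deriv_skew [OF \<alpha> X that] .
  show "\<L> M X \<alpha> ((\<lambda>f. g * Y f + Z f) # Ys) = g * \<L> M X \<alpha> (Y # Ys) + \<L> M X \<alpha> (Z # Ys)"
    if g: "g \<in> C\<^sup>\<infinity> M" and YZ: "set (Y # Z # Ys) \<subseteq> \<XX> M" for Y Z Ys g
  proof -
    have vfs: "Y \<in> \<XX> M" "Z \<in> \<XX> M" "set Ys \<subseteq> \<XX> M" "vf_bracket X Y \<in> \<XX> M" "vf_bracket X Z \<in> \<XX> M"
      using YZ X by (auto intro: vf_bracket_closed)
    define C where "C = (\<lambda>f. g * Y f + Z f)"
    have C: "C \<in> \<XX> M"
      unfolding C_def by (rule vf_combination [OF vfs(1,2) g])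
    have "\<alpha> (vf_bracket X C # Ys)
        = X g * \<alpha> (Y # Ys) + (g * \<alpha> (vf_bracket X Y # Ys) + \<alpha> (vf_bracket X Z # Ys))"
      unfolding C_def vf_bracket_combination [OF X vfs(1,2) g]
      using form_combination [OF \<alpha> vfs(1) vf_combination [OF vfs(4,5) g] vf_smooth [OF X], of "[]"]
        form_combination [OF \<alpha> vfs(4,5) g, of "[]"] by simp
    moreover have "contract C \<alpha> = (\<lambda>Zs. g * contract Y \<alpha> Zs + contract Z \<alpha> Zs)"
      using form_combination [OF \<alpha> vfs(1,2) g, of "[]"] by (simp add: C_def contract_def fun_eq_iff)
    then have "\<L> M X (contract C \<alpha>) Ys
        = X g * \<alpha> (Y # Ys) + g * \<L> M X (contract Y \<alpha>) Ys + \<L> M X (contract Z \<alpha>) Ys"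
      using lie_deriv_combination [OF X _ _ g vfs(3), of "contract Y \<alpha>" "contract Z \<alpha>"]
      by (simp add: contract_def form_smooth [OF \<alpha>])
    ultimately show ?thesis
      unfolding C_def [symmetric] using vfs C by (simp add: lie_deriv_Cons algebra_simps)
  qed
qed

lemma ext_deriv_smooth:
  assumes "\<alpha> \<in> \<Omega> M k"
  shows "\<d> M \<alpha> Xs \<in> C\<^sup>\<infinity> M"
proof (cases "set Xs \<subseteq> \<XX> M")
  case True
  then show ?thesis
    using assms
  proof (induction Xs arbitrary: \<alpha> k)
    case (Cons X Xs)
    then have "\<d> M (contract X \<alpha>) Xs \<in> C\<^sup>\<infinity> M" "\<L> M X \<alpha> Xs \<in> C\<^sup>\<infinity> M" "X \<in> \<XX> M"
      by (auto intro: form_smooth [OF lie_deriv_form] contract_form)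
    then show ?case
      using ext_deriv_Cons [OF Cons.prems(2)] by (metis smooth_diff)
  qed (simp add: smooth_zero)
qed (simp add: ext_deriv_def smooth_zero)

lemma ext_deriv_wrong_degree:
  assumes "\<alpha> \<in> \<Omega> M k" "set Xs \<subseteq> \<XX> M" "length Xs \<noteq> Suc k"
  shows "\<d> M \<alpha> Xs = 0"
  using assms
proof (induction Xs arbitrary: \<alpha> k)
  case (Cons X Xs)
  have "\<L> M X \<alpha> Xs = 0"
    using Cons.prems by (intro form_undefined [OF lie_deriv_form]) auto
  moreover have "\<d> M (contract X \<alpha>) Xs = 0"
  proof (cases k)
    case 0
    then have "contract X \<alpha> = 0"
      using form_undefined [OF Cons.prems(1)] by (intro ext) (simp add: contract_def)
    then show ?thesis
      by (simp add: ext_deriv_zero)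
  next
    case (Suc j)
    with Cons.prems show ?thesis
      by (intro Cons.IH [of _ "k - 1"] contract_form) auto
  qed
  ultimately show ?case
    using Cons.prems by (simp add: ext_deriv_Cons)
qed simp

text \<open>
  Again the arguments in front are contracted away, now by Cartan's formula. At the head, applying it
  twice gives
  \<open>\<iota> Z (\<iota> Y (d \<alpha>)) = \<L> Y (\<iota> Z \<alpha>) - \<iota> [Y, Z] \<alpha> - \<L> Z (\<iota> Y \<alpha>) + d (\<iota> Z (\<iota> Y \<alpha>))\<close>,
  which is visibly skew in \<open>Y\<close> and \<open>Z\<close>.
\<close>

lemma ext_deriv_skew:
  assumes "\<alpha> \<in> \<Omega> M k" "set (Xs @ Y # Z # Ys) \<subseteq> \<XX> M"
  shows "\<d> M \<alpha> (Xs @ Y # Z # Ys) = - \<d> M \<alpha> (Xs @ Z # Y # Ys)"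
  using assms
proof (induction Xs arbitrary: \<alpha> k)
  case Nil
  have vfs: "Y \<in> \<XX> M" "Z \<in> \<XX> M" "set Ys \<subseteq> \<XX> M"
    using Nil by auto
  have "\<d> M (contract Z (contract Y \<alpha>)) = - \<d> M (contract Y (contract Z \<alpha>))"
    using contract_swap [OF Nil(1), of Z Y] ext_deriv_uminus [of "contract Y (contract Z \<alpha>)" M]
    by (simp add: contract_def form_smooth [OF Nil(1)])
  moreover have "\<alpha> (vf_bracket Z Y # Ys) = - \<alpha> (vf_bracket Y Z # Ys)"
    using form_uminus [OF Nil(1) vf_bracket_closed [OF vfs(1,2)], of "[]" Ys]
    by (simp add: vf_bracket_skew [of Z Y])
  ultimately show ?case
    using vfs by (simp add: ext_deriv_Cons [OF Nil(1)] ext_deriv_Cons [OF contract_form [OF Nil(1)]]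
        lie_deriv_Cons)
      (simp add: fun_eq_iff)
next
  case (Cons W Xs)
  have "\<d> M (contract W \<alpha>) (Xs @ Y # Z # Ys) = - \<d> M (contract W \<alpha>) (Xs @ Z # Y # Ys)"
    using Cons.prems by (intro Cons.IH [OF contract_form]) auto
  moreover have "\<L> M W \<alpha> (Xs @ Y # Z # Ys) = - \<L> M W \<alpha> (Xs @ Z # Y # Ys)"
    using Cons.prems by (intro lie_deriv_skew) auto
  ultimately show ?case
    using Cons.prems by (simp add: ext_deriv_Cons)
qed

text \<open>
  Cartan's formula at the combination itself would involve the Lie derivative along \<open>g Y + Z\<close>, which
  is not function-linear. If there is another argument \<open>W\<close>, it is swapped to the front and
  contracted first, so that only the function-linearity of \<open>\<L> W \<alpha>\<close> is used; for a single argument,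
  \<open>d\<close> of the function \<open>\<alpha> []\<close> is linear by the definition of the combination.
\<close>

lemma ext_deriv_combination:
  assumes "\<alpha> \<in> \<Omega> M k" "g \<in> C\<^sup>\<infinity> M" "set (Y # Z # Ys) \<subseteq> \<XX> M"
  shows "\<d> M \<alpha> ((\<lambda>f. g * Y f + Z f) # Ys) = g * \<d> M \<alpha> (Y # Ys) + \<d> M \<alpha> (Z # Ys)"
  using assms
proof (induction Ys arbitrary: \<alpha> k)
  case Nil
  then have vfs: "Y \<in> \<XX> M" "Z \<in> \<XX> M"
    by auto
  show ?case
    unfolding ext_deriv_Cons [OF Nil(1) vf_combination [OF vfs Nil(2)]]
      ext_deriv_Cons [OF Nil(1) vfs(1)] ext_deriv_Cons [OF Nil(1) vfs(2)] lie_deriv_Nil ext_deriv_Nil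
    by simp
next
  case (Cons W Ys)
  define C where "C = (\<lambda>f. g * Y f + Z f)"
  have vfs: "Y \<in> \<XX> M" "Z \<in> \<XX> M" "W \<in> \<XX> M" "set Ys \<subseteq> \<XX> M"
    using Cons.prems by auto
  have C: "C \<in> \<XX> M"
    unfolding C_def by (rule vf_combination [OF vfs(1,2) Cons.prems(2)])
  have swap: "\<d> M \<alpha> (A # W # Ys) = \<d> M (contract W \<alpha>) (A # Ys) - \<L> M W \<alpha> (A # Ys)" if "A \<in> \<XX> M" for A
    using that vfs ext_deriv_skew [OF Cons.prems(1), of "[]" A W Ys]
    by (simp add: ext_deriv_Cons [OF Cons.prems(1) vfs(3)])
  have "\<d> M (contract W \<alpha>) (C # Ys)
      = g * \<d> M (contract W \<alpha>) (Y # Ys) + \<d> M (contract W \<alpha>) (Z # Ys)"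
    unfolding C_def using Cons.prems by (intro Cons.IH [OF contract_form]) auto
  moreover have "\<L> M W \<alpha> (C # Ys) = g * \<L> M W \<alpha> (Y # Ys) + \<L> M W \<alpha> (Z # Ys)"
    using form_combination [OF lie_deriv_form [OF Cons.prems(1) vfs(3)] vfs(1,2) Cons.prems(2), of "[]"]
    by (simp add: C_def)
  ultimately show ?case
    unfolding C_def [symmetric] swap [OF C] swap [OF vfs(1)] swap [OF vfs(2)]
    by (simp add: algebra_simps)
qed

lemma ext_deriv_form:
  assumes "\<alpha> \<in> \<Omega> M k"
  shows "\<d> M \<alpha> \<in> \<Omega> M (Suc k)"
proof (rule formsI)
  show "\<d> M \<alpha> Xs = 0" if "\<not> (length Xs = Suc k \<and> set Xs \<subseteq> \<XX> M)" for Xs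
    using that ext_deriv_wrong_degree [OF assms] by (cases "set Xs \<subseteq> \<XX> M") (auto simp: ext_deriv_def)
qed (rule ext_deriv_smooth [OF assms] ext_deriv_skew [OF assms] ext_deriv_combination [OF assms];
    assumption)+


section \<open>The Cartan calculus\<close>

lemma contract_zero: "contract X 0 = 0"
  by (intro ext) (simp add: contract_def)

lemma lie_deriv_contract:
  assumes "\<alpha> \<in> \<Omega> M k" "X \<in> \<XX> M" "Y \<in> \<XX> M"
  shows "contract Y (\<L> M X \<alpha>) = \<L> M X (contract Y \<alpha>) - contract (vf_bracket X Y) \<alpha>"
proof
  fix Ys
  show "contract Y (\<L> M X \<alpha>) Ys = (\<L> M X (contract Y \<alpha>) - contract (vf_bracket X Y) \<alpha>) Ys"
  proof (cases "set Ys \<subseteq> \<XX> M")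
    case True
    with assms(3) show ?thesis
      using lie_deriv_Cons [of Y M Ys X \<alpha>] by (simp add: contract_def)
  next
    case False
    then show ?thesis
      by (simp add: contract_def lie_deriv_def form_undefined [OF assms(1)])
  qed
qed

text \<open>
  Expanding \<open>\<L> X (\<L> Y \<alpha>)\<close> at \<open>Z # Zs\<close>, the terms with a single bracket are symmetric in \<open>X\<close> and \<open>Y\<close>
  and cancel in the commutator. The terms with double brackets match by the Jacobi identity.
\<close>

lemma lie_deriv_bracket:
  assumes "\<alpha> \<in> \<Omega> M k" "X \<in> \<XX> M" "Y \<in> \<XX> M" 
  shows "\<L> M (vf_bracket X Y) \<alpha> Zs = \<L> M X (\<L> M Y \<alpha>) Zs - \<L> M Y (\<L> M X \<alpha>) Zs"
proof (cases "set Zs \<subseteq> \<XX> M")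
  case True
  then show ?thesis
    using assms(1)
  proof (induction Zs arbitrary: \<alpha> k)
    case Nil
    then show ?case
      by (simp add: vf_bracket_def)
  next
    case (Cons Z Zs)
    have Z: "Z \<in> \<XX> M" and Zs: "set Zs \<subseteq> \<XX> M"
      using Cons.prems by auto
    note \<alpha> = Cons.prems(2)
    have double: "\<L> M A (\<L> M B \<alpha>) (Z # Zs)
        = \<L> M A (\<L> M B (contract Z \<alpha>)) Zs - \<L> M A (contract (vf_bracket B Z) \<alpha>) Zs
          - \<L> M B (contract (vf_bracket A Z) \<alpha>) Zs + \<alpha> (vf_bracket B (vf_bracket A Z) # Zs)"
      if "A \<in> \<XX> M" "B \<in> \<XX> M" for A B
    proof -
      have "\<L> M A (contract Z (\<L> M B \<alpha>))
          = \<L> M A (\<L> M B (contract Z \<alpha>)) - \<L> M A (contract (vf_bracket B Z) \<alpha>)"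
        unfolding lie_deriv_contract [OF \<alpha> that(2) Z] using that \<alpha> Z
        by (intro lie_deriv_diff form_smooth [OF lie_deriv_form [OF contract_form]]
            form_smooth [OF contract_form] vf_bracket_closed)
      then show ?thesis
        using that Z Zs by (simp add: lie_deriv_Cons vf_bracket_closed)
    qed
    let ?XZ = "vf_bracket X Z" and ?YZ = "vf_bracket Y Z"
    have brs: "vf_bracket X ?YZ \<in> \<XX> M" "vf_bracket Y ?XZ \<in> \<XX> M"
      using assms Z by (auto intro: vf_bracket_closed)
    have "\<alpha> (vf_bracket (vf_bracket X Y) Z # Zs)
        = \<alpha> (vf_bracket X ?YZ # Zs) - \<alpha> (vf_bracket Y ?XZ # Zs)"
      using form_diff [OF \<alpha> brs, of "[]" Zs] by (simp add: vf_bracket_jacobi [OF assms(2,3) Z])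
    moreover have "\<L> M (vf_bracket X Y) (contract Z \<alpha>) Zs
        = \<L> M X (\<L> M Y (contract Z \<alpha>)) Zs - \<L> M Y (\<L> M X (contract Z \<alpha>)) Zs"
      using Cons.IH [OF Zs contract_form [OF \<alpha> Z]] .
    ultimately show ?case
      using Z Zs by (simp add: double assms(2,3) lie_deriv_Cons [of Z M Zs "vf_bracket X Y"])
        (simp add: fun_eq_iff)
  qed
qed (simp add: lie_deriv_def)

text \<open>
  Formally, \<open>[\<L> X, \<iota> Y] = \<iota> [X, Y]\<close>, Cartan's formula and \<open>[\<L> X, \<L> Y] = \<L> [X, Y]\<close> give
  \<open>\<iota> Y [\<L> X, d] = - [\<L> X, d] \<iota> Y\<close>, so that the commutator vanishes by induction over the arguments; on
  the empty list it vanishes because \<open>d\<close> does.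
\<close>

lemma lie_deriv_ext_deriv:
  assumes "\<alpha> \<in> \<Omega> M k" "X \<in> \<XX> M"
  shows "\<L> M X (\<d> M \<alpha>) = \<d> M (\<L> M X \<alpha>)"
proof
  fix Ys
  show "\<L> M X (\<d> M \<alpha>) Ys = \<d> M (\<L> M X \<alpha>) Ys"
  proof (cases "set Ys \<subseteq> \<XX> M")
    case True
    then show ?thesis
      using assms(1)
    proof (induction Ys arbitrary: \<alpha> k)
      case Nil
      then show ?case
        using assms(2) by (simp add: vf_zero)
    next
      case (Cons Y Ys)
      have Y: "Y \<in> \<XX> M" and Ys: "set Ys \<subseteq> \<XX> M" and XY: "vf_bracket X Y \<in> \<XX> M"
        using Cons.prems assms(2) by (auto intro: vf_bracket_closed)
      note \<alpha> = Cons.prems(2) and X = assms(2)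
      note smooth = form_smooth [OF lie_deriv_form] form_smooth [OF contract_form] ext_deriv_smooth contract_form lie_deriv_form
      have 1: "\<L> M X (contract Y (\<d> M \<alpha>)) = \<L> M X (\<L> M Y \<alpha>) - \<L> M X (\<d> M (contract Y \<alpha>))"
        unfolding cartan [OF \<alpha> Y] using \<alpha> X Y by (intro lie_deriv_diff) (auto intro: smooth)
      have 2: "\<d> M (contract Y (\<L> M X \<alpha>)) = \<d> M (\<L> M X (contract Y \<alpha>)) - \<d> M (contract (vf_bracket X Y) \<alpha>)"
        unfolding lie_deriv_contract [OF \<alpha> X Y] using \<alpha> X Y XY by (intro ext_deriv_diff) (auto intro: smooth)
      have "\<L> M X (\<d> M \<alpha>) (Y # Ys)
          = \<L> M X (\<L> M Y \<alpha>) Ys - \<L> M X (\<d> M (contract Y \<alpha>)) Ys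
            - \<L> M (vf_bracket X Y) \<alpha> Ys + \<d> M (contract (vf_bracket X Y) \<alpha>) Ys"
        using Y Ys by (simp add: lie_deriv_Cons 1 ext_deriv_Cons [OF \<alpha> XY])
      also have "\<dots> = \<L> M Y (\<L> M X \<alpha>) Ys - \<d> M (\<L> M X (contract Y \<alpha>)) Ys
          + \<d> M (contract (vf_bracket X Y) \<alpha>) Ys"
        using Cons.IH [OF Ys contract_form [OF \<alpha> Y]] lie_deriv_bracket [OF \<alpha> X Y, of Ys] by simp
      also have "\<dots> = \<d> M (\<L> M X \<alpha>) (Y # Ys)"
        by (simp add: ext_deriv_Cons [OF lie_deriv_form [OF \<alpha> X] Y] 2)
      finally show ?case .
    qed
  qed (simp add: lie_deriv_def ext_deriv_def)
qed

text \<open>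
  Cartan's formula, applied to \<open>d \<alpha>\<close> and to \<open>\<alpha>\<close>, and \<open>\<L> Y d = d \<L> Y\<close> give
  \<open>\<iota> Y d d = \<L> Y d - d (\<L> Y - d \<iota> Y) = d d \<iota> Y\<close>.
\<close>

lemma ext_deriv_ext_deriv:
  assumes "\<alpha> \<in> \<Omega> M k"
  shows "\<d> M (\<d> M \<alpha>) = 0"
proof
  fix Ys
  show "\<d> M (\<d> M \<alpha>) Ys = 0 Ys"
  proof (cases "set Ys \<subseteq> \<XX> M")
    case True
    then show ?thesis
      using assms
    proof (induction Ys arbitrary: \<alpha> k)
      case (Cons Y Ys)
      have Y: "Y \<in> \<XX> M" and Ys: "set Ys \<subseteq> \<XX> M"
        using Cons.prems by auto
      note \<alpha> = Cons.prems(2)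
      have "\<d> M (contract Y (\<d> M \<alpha>)) = \<d> M (\<L> M Y \<alpha>) - \<d> M (\<d> M (contract Y \<alpha>))"
        unfolding cartan [OF \<alpha> Y] using \<alpha> Y
        by (intro ext_deriv_diff) (auto intro: form_smooth [OF lie_deriv_form] ext_deriv_smooth contract_form)
      then show ?case
        using Cons.IH [OF Ys contract_form [OF \<alpha> Y]]
        by (simp add: ext_deriv_Cons [OF ext_deriv_form [OF \<alpha>] Y] lie_deriv_ext_deriv [OF \<alpha> Y])
    qed simp
  qed (simp add: ext_deriv_def)
qed


section \<open>Conservation of the co-momentum map on cycles\<close>

text \<open>
  The three properties of \<open>\<omega>\<close> that are used (being a form, invariance under \<open>X\<close>, vanishing
  contraction with all \<open>[X, v x]\<close>) are inherited by \<open>\<iota>(v x) \<omega>\<close>; the invariance by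
  \<open>\<L> X (\<iota>(v x) \<omega>) = \<iota>(v x) (\<L> X \<omega>) + \<iota>[X, v x] \<omega>\<close>. Hence they pass to contractions with wedge products
  and, by linearity, to all elements of the exterior power.
\<close>

lemma lie_deriv_contract_ext_zero:
  assumes \<omega>: "\<omega> \<in> \<Omega> M m" and X: "X \<in> \<XX> M" and "linear v" and v: "\<And>x. v x \<in> \<XX> M"
    and inv: "\<L> M X \<omega> = 0" and br: "\<And>x. contract (vf_bracket X (v x)) \<omega> = 0"
    and p: "p \<in> \<Lambda> k"
  shows "\<L> M X (contract_ext v p \<omega>) = 0"
proof -
  have word: "fold (\<lambda>x. contract (v x)) xs \<beta> \<in> \<Omega> M (l - length xs) \<and>
      \<L> M X (fold (\<lambda>x. contract (v x)) xs \<beta>) = 0"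
    if "\<beta> \<in> \<Omega> M l" "\<L> M X \<beta> = 0" "\<And>x. contract (vf_bracket X (v x)) \<beta> = 0" for xs \<beta> l
    using that
  proof (induction xs arbitrary: \<beta> l)
    case (Cons x xs)
    have "\<L> M X (contract (v x) \<beta>) = 0"
      using lie_deriv_contract [OF Cons.prems(1) X v, of x]
      unfolding Cons.prems(2,3) contract_zero by simp
    moreover have "contract (vf_bracket X (v y)) (contract (v x) \<beta>) = 0" for y
      using contract_swap [OF Cons.prems(1), of "vf_bracket X (v y)" "v x"]
      unfolding Cons.prems(3) contract_zero by simp
    ultimately show ?case
      using Cons.IH [OF contract_form [OF Cons.prems(1) v]] by simp
  qed simp
  \<comment> \<open>Membership in the forms is carried along because the Lie derivative is additive only on
      maps with smooth values.\<close>
  let ?S = "{p. contract_ext v p \<omega> \<in> \<Omega> M (m - k) \<and> \<L> M X (contract_ext v p \<omega>) = 0}"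
  interpret linear "\<lambda>p. contract_ext v p \<omega>"
    unfolding contract_ext_def by (rule linear_ext_extend [OF alternating_contract [OF \<omega> \<open>linear v\<close> v]])
  have "subspace ?S"
  proof (rule subspaceI)
    show "0 \<in> ?S"
      by (simp add: zero subspace_0 [OF subspace_forms] lie_deriv_zero [OF X])
    show "q + r \<in> ?S" if "q \<in> ?S" "r \<in> ?S" for q r
    proof -
      have q: "contract_ext v q \<omega> \<in> \<Omega> M (m - k)" and r: "contract_ext v r \<omega> \<in> \<Omega> M (m - k)"
        using that by auto
      show ?thesis
        using that lie_deriv_lincomb [of X M "contract_ext v q \<omega>" "contract_ext v r \<omega>" 1,
            OF X form_smooth [OF q] form_smooth [OF r]]
        by (simp add: add subspace_add [OF subspace_forms q r])
    qed
    show "c *\<^sub>R q \<in> ?S" if "q \<in> ?S" for c q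
    proof -
      have q: "contract_ext v q \<omega> \<in> \<Omega> M (m - k)"
        using that by auto
      show ?thesis
        using that lie_deriv_scaleR [of X M "contract_ext v q \<omega>", OF X form_smooth [OF q]]
        by (simp add: scale subspace_scale [OF subspace_forms q])
    qed
  qed
  moreover have "{wedge xs | xs. length xs = k} \<subseteq> ?S"
    using word [OF \<omega> inv br] by (auto simp: contract_ext_wedge [OF \<omega> \<open>linear v\<close> v])
  ultimately have "p \<in> ?S"
    using p span_minimal [of "{wedge xs | xs. length xs = k}" ?S] unfolding ext_power_def by blast
  then show ?thesis
    by simp
qed

text \<open>
  The boundary term vanishes for \<open>k = 1\<close> by the convention \<open>f\<^sub>0 = 0\<close> and otherwise because \<open>f\<close> is linear
  in degree \<open>k - 1\<close>.
\<close>

lemma comomentum_cycle: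
  fixes br :: "'g::real_vector \<Rightarrow> 'g \<Rightarrow> 'g"
  assumes f: "comomentum_map M n \<omega> br v f" and k: "1 \<le> k" "k \<le> n" and p: "p \<in> cycles br k"
  shows "\<d> M (f k p) = - \<varsigma> k *\<^sub>R contract_ext v p \<omega>"
proof -
  define F where "F = (\<lambda>i. if i \<in> {1..n} then f i else 0)"
  have "\<forall>k \<in> {1..n + 1}. \<forall>p \<in> \<Lambda> k.
      - F (k - 1) (boundary br p) = \<d> M (F k p) + \<varsigma> k *\<^sub>R contract_ext v p \<omega>"
    using f unfolding comomentum_map_def F_def Let_def by blast
  moreover have "k \<in> {1..n + 1}" "p \<in> \<Lambda> k"
    using k p by (auto simp: cycles_def)
  ultimately have "- F (k - 1) (boundary br p) = \<d> M (F k p) + \<varsigma> k *\<^sub>R contract_ext v p \<omega>"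
    by blast
  then have "- F (k - 1) 0 = \<d> M (f k p) + \<varsigma> k *\<^sub>R contract_ext v p \<omega>"
    using k p by (simp add: cycles_def F_def)
  moreover have "F (k - 1) 0 = 0"
  proof (cases "k - 1 \<in> {1..n}")
    case True
    have "(0 :: 'g ext) \<in> \<Lambda> (k - 1)"
      by (simp add: ext_power_def span_zero)
    then have "f (k - 1) (1 *\<^sub>R 0 + 0) = 1 *\<^sub>R f (k - 1) 0 + f (k - 1) 0"
      using f True unfolding comomentum_map_def by blast
    with True show ?thesis
      by (simp add: F_def)
  qed (auto simp: F_def)
  ultimately show ?thesis
    by (simp add: eq_neg_iff_add_eq_0 scaleR_minus_left)
qed

text \<open>
  Cartan's formula gives \<open>\<L> X \<omega> = \<iota> X (d \<omega>) + d (\<iota> X \<omega>) = - d (d H)\<close>.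
\<close>

lemma hamiltonian_vf_invariance:
  assumes \<omega>: "closed_form M (n + 1) \<omega>" and H: "H \<in> \<Omega> M l" and X: "hamiltonian_vf M \<omega> H X"
  shows "\<L> M X \<omega> = 0"
proof -
  have "\<omega> \<in> \<Omega> M (n + 1)" "\<d> M \<omega> = 0" "X \<in> \<XX> M" "\<d> M H = - contract X \<omega>"
    using \<omega> X by (auto simp: closed_form_def hamiltonian_vf_def)
  then have "contract X 0 = \<L> M X \<omega> - \<d> M (- \<d> M H)"
    using cartan [of \<omega> M "n + 1" X] by simp
  moreover have "\<d> M (- \<d> M H) = 0"
    using ext_deriv_uminus [OF ext_deriv_smooth [OF H]] ext_deriv_ext_deriv [OF H] by simp
  ultimately show ?thesis
    by (simp add: contract_zero)
qed

text \<open>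
  If \<open>Y\<close> preserves \<open>\<omega>\<close>, then
  \<open>\<iota> [Y, X] \<omega> = \<L> Y (\<iota> X \<omega>) - \<iota> X (\<L> Y \<omega>) = - \<L> Y (d H) = - d (\<L> Y H)\<close>.
\<close>

lemma contract_bracket_hamiltonian:
  assumes \<omega>: "\<omega> \<in> \<Omega> M m" and H: "H \<in> \<Omega> M l" and X: "hamiltonian_vf M \<omega> H X"
    and Y: "Y \<in> \<XX> M" "\<L> M Y \<omega> = 0" "\<d> M (\<L> M Y H) = 0"
  shows "contract (vf_bracket X Y) \<omega> = 0"
proof -
  have X': "X \<in> \<XX> M" and dH: "contract X \<omega> = - \<d> M H"
    using X by (auto simp: hamiltonian_vf_def)
  have "\<L> M Y (contract X \<omega>) = 0"
    unfolding dH lie_deriv_uminus [OF Y(1) ext_deriv_smooth [OF H]] lie_deriv_ext_deriv [OF H Y(1)] Y(3)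
    by simp
  then have "contract (vf_bracket Y X) \<omega> = 0"
    using lie_deriv_contract [OF \<omega> Y(1) X'] Y(2) by (simp add: contract_zero)
  moreover have "contract (vf_bracket X Y) \<omega> = - contract (vf_bracket Y X) \<omega>"
    using form_uminus [OF \<omega> vf_bracket_closed [OF Y(1) X'], of "[]"]
    by (intro ext) (simp add: contract_def vf_bracket_skew [of X Y])
  ultimately show ?thesis
    by simp
qed

theorem proposition2p12:
  fixes M :: "'m::{t2_space, second_countable_topology} manifold"
    and n k :: nat
    and \<omega> H :: "'m dform"
    and br :: "'g::real_vector \<Rightarrow> 'g \<Rightarrow> 'g"
    and v :: "'g \<Rightarrow> 'm vfield"
    and f :: "nat \<Rightarrow> 'g ext \<Rightarrow> 'm dform"
    and p :: "'g ext"
    and v\<^sub>H :: "'m vfield"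
  assumes "pre_plectic M n \<omega>"
    and "H \<in> hamiltonian_forms M n \<omega>"
    and "lie_algebra br"
    and "multisymplectic_action M \<omega> br v"
    and "comomentum_map M n \<omega> br v f"
    and "\<forall>x. closed_form M (n - 1) (\<L> M (v x) H)"
    and "1 \<le> k" and "k \<le> n"
    and "p \<in> cycles br k"
    and "hamiltonian_vf M \<omega> H v\<^sub>H"
  shows "closed_form M (n - k) (\<L> M v\<^sub>H (f k p))"
proof -
  have \<omega>: "\<omega> \<in> \<Omega> M (n + 1)" "closed_form M (n + 1) \<omega>"
    using assms(1) by (auto simp: pre_plectic_def closed_form_def)
  have H: "H \<in> \<Omega> M (n - 1)" and vH: "v\<^sub>H \<in> \<XX> M"
    using assms(2,10) by (auto simp: hamiltonian_forms_def hamiltonian_vf_def)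
  have v: "linear v" "v x \<in> \<XX> M" "\<L> M (v x) \<omega> = 0" for x
    using assms(4) by (auto simp: multisymplectic_action_def)
  have fp: "f k p \<in> \<Omega> M (n - k)" and p: "p \<in> \<Lambda> k"
    using assms(5,7,8,9) by (auto simp: comomentum_map_def cycles_def)
  have "contract (vf_bracket v\<^sub>H (v x)) \<omega> = 0" for x
    using assms(6) by (intro contract_bracket_hamiltonian [OF \<omega>(1) H assms(10) v(2,3)])
      (simp add: closed_form_def)
  then have contract: "\<L> M v\<^sub>H (contract_ext v p \<omega>) = 0"
    using lie_deriv_contract_ext_zero [OF \<omega>(1) vH v(1,2) hamiltonian_vf_invariance [OF \<omega>(2) H assms(10)] _ p]
    by blast
  have "\<varsigma> k \<noteq> 0"
    by (simp add: sgn_factor_def)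
  then have "contract_ext v p \<omega> = (- inverse (\<varsigma> k)) *\<^sub>R \<d> M (f k p)"
    using comomentum_cycle [OF assms(5,7,8,9)] by simp
  then have "\<L> M v\<^sub>H ((- inverse (\<varsigma> k)) *\<^sub>R \<d> M (f k p)) = 0"
    using contract by (simp only:)
  then have "(- inverse (\<varsigma> k)) *\<^sub>R \<L> M v\<^sub>H (\<d> M (f k p)) = 0"
    unfolding lie_deriv_scaleR [of v\<^sub>H M "\<d> M (f k p)", OF vH ext_deriv_smooth [OF fp]] .
  with \<open>\<varsigma> k \<noteq> 0\<close> have "\<d> M (\<L> M v\<^sub>H (f k p)) = 0"
    by (simp add: lie_deriv_ext_deriv [OF fp vH])
  then show ?thesis
    using lie_deriv_form [OF fp vH] by (simp add: closed_form_def)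
qed

end
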